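(* Let $n\ge 1$, let $q$ be a prime power, and let $K$ be the Markov chain on $\mathrm{Irr}(GL(n,q))$ defined from the representation $\eta$ of $GL(n,q)$ whose character is $g\mapsto q^{d(g)}$, where $d(g)$ is the dimension of the fixed space of $g$ on $\mathbb{F}_q^n$. Let $\pi$ be the Plancherel measure of $GL(n,q)$. Then for every $\Lambda\in\mathrm{Irr}(GL(n,q))$ and every integer $r\ge 0$, $$ \frac{K^r(\hat 1,\Lambda)}{\pi(\Lambda)} = \sum_{a=0}^n P_q(a,r,n)\,\frac{c_a(\Lambda)}{d_\Lambda}.$$
   Context: All representations are finite-dimensional complex representations. For a finite group $G$, $\mathrm{Irr}(G)$ is the set of (isomorphism classes of) irreducible representations, $d_\lambda$ is the dimension of $\lambda$, $\chi^\lambda$ its character, and $m_\rho(V)$ is the multiplicity of the irreducible $\rho$ in the representation $V$. Given a representation $\eta$ of $G$ with real-valued character, the associated Markov chain on $\mathrm{Irr}(G)$ has transition probabilities $$K(\lambda,\rho)=\frac{d_\rho\, m_\rho(\lambda\otimes\eta)}{d_\lambda d_\eta},$$ and $K^r(\lambda,\rho)$ denotes the $r$-step transition probability. The Plancherel measure is $\pi(\lambda)=d_\lambda^2/|G|$. The trivial representation is denoted $\hat 1$. Here $G=GL(n,q)$ and $\eta$ is the permutation representation on the $q^n$ vectors of $\mathbb{F}_q^n$. $P_q(a,r,n)$ denotes the probability that the span of $\vec v_1,\dots,\vec v_r$ is $a$-dimensional, where the $r$ vectors are chosen independently and uniformly at random from an $n$-dimensional vector space over $\mathbb{F}_q$.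 For $0\le k\le n$, $H(k,q)$ is the subgroup of $GL(n,q)$ consisting of those $g$ that fix each of the first $k$ standard basis vectors $\vec e_1,\dots,\vec e_k$ of $\mathbb{F}_q^n$, and $$c_k(\Lambda)=\sum_{g\in H(k,q)}\chi^\Lambda(g).$$ *)

theory Defs
  imports
    "HOL-Probability.Probability_Mass_Function"
    "Jordan_Normal_Form.VS_Connect"
begin

text \<open>Conventions: \<open>\<F>\<^sub>q\<close> is a finite field type \<open>'f\<close> with \<open>CARD('f) = q\<close>, its \<open>n\<close>-dimensional
  vector space is \<open>carrier_vec n\<close>, and coordinates are numbered from \<open>0\<close>.\<close>

definition GL :: "'a::semiring_1 itself \<Rightarrow> nat \<Rightarrow> 'a mat monoid" where
  "GL ty n = units_of (ring_mat ty n ())"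

text \<open>A representation is a pair of its degree \<open>d\<close> and a map from the group to complex
  \<open>d \<times> d\<close> matrices. The values of this map outside the carrier of the group are irrelevant.\<close>

type_synonym 'g rep = "nat \<times> ('g \<Rightarrow> complex mat)"

definition is_rep :: "('g, 'b) monoid_scheme \<Rightarrow> 'g rep \<Rightarrow> bool" where
  "is_rep G V \<longleftrightarrow> snd V \<in> hom G (GL TYPE(complex) (fst V))"

definition character :: "'g rep \<Rightarrow> 'g \<Rightarrow> complex" where
  "character V g = (\<Sum>i<fst V. snd V g $$ (i, i))"

definition irreducible_rep :: "('g, 'b) monoid_scheme \<Rightarrow> 'g rep \<Rightarrow> bool" where
  "irreducible_rep G V \<longleftrightarrow> is_rep G V \<and> fst V > 0 \<and>
     (\<forall>W. VectorSpace.subspace class_ring W (module_vec TYPE(complex) (fst V)) \<and>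
          (\<forall>g \<in> carrier G. \<forall>w \<in> W. snd V g *\<^sub>v w \<in> W) \<longrightarrow>
        W = {0\<^sub>v (fst V)} \<or> W = carrier_vec (fst V))"

definition rep_iso :: "('g, 'b) monoid_scheme \<Rightarrow> 'g rep \<Rightarrow> 'g rep \<Rightarrow> bool" where
  "rep_iso G V W \<longleftrightarrow> is_rep G V \<and> is_rep G W \<and> fst V = fst W \<and>
     (\<exists>P \<in> carrier (GL TYPE(complex) (fst V)). \<forall>g \<in> carrier G. P * snd V g = snd W g * P)"

definition trivial_rep :: "'g rep" where
  "trivial_rep = (1, \<lambda>g. 1\<^sub>m 1)"

definition direct_sum_rep :: "'g rep list \<Rightarrow> 'g rep" where
  "direct_sum_rep Vs = (sum_list (map fst Vs), \<lambda>g. diag_block_mat (map (\<lambda>V. snd V g) Vs))"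

definition kronecker_product :: "complex mat \<Rightarrow> complex mat \<Rightarrow> complex mat" where
  "kronecker_product A B = mat (dim_row A * dim_row B) (dim_col A * dim_col B)
     (\<lambda>(i, j). A $$ (i div dim_row B, j div dim_col B) * B $$ (i mod dim_row B, j mod dim_col B))"

definition tensor_rep :: "'g rep \<Rightarrow> 'g rep \<Rightarrow> 'g rep" where
  "tensor_rep V W = (fst V * fst W, \<lambda>g. kronecker_product (snd V g) (snd W g))"

definition irr_iso_rel :: "('g, 'b) monoid_scheme \<Rightarrow> ('g rep \<times> 'g rep) set" where
  "irr_iso_rel G = {(V, W). irreducible_rep G V \<and> irreducible_rep G W \<and> rep_iso G V W}"

definition Irr :: "('g, 'b) monoid_scheme \<Rightarrow> 'g rep set set" where
  "Irr G = {V. irreducible_rep G V} // irr_iso_rel G"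

definition trivial_irr :: "('g, 'b) monoid_scheme \<Rightarrow> 'g rep set" where
  "trivial_irr G = irr_iso_rel G `` {trivial_rep}"

text \<open>Dimension, character and multiplicities are invariants of the isomorphism class, so they
  may be computed from an arbitrary representative.\<close>

definition representative :: "'g rep set \<Rightarrow> 'g rep" where
  "representative \<Lambda> = (SOME V. V \<in> \<Lambda>)"

definition irr_dim :: "'g rep set \<Rightarrow> nat" where
  "irr_dim \<Lambda> = fst (representative \<Lambda>)"

definition irr_character :: "'g rep set \<Rightarrow> 'g \<Rightarrow> complex" where
  "irr_character \<Lambda> = character (representative \<Lambda>)"

text \<open>The number of summands in the class \<open>\<rho>\<close> in any decomposition of \<open>V\<close> into irreducibles;
  such a decomposition exists by Maschke's theorem, and the number does not depend on it.\<close>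

definition multiplicity_in :: "('g, 'b) monoid_scheme \<Rightarrow> 'g rep set \<Rightarrow> 'g rep \<Rightarrow> nat" where
  "multiplicity_in G \<rho> V = (THE m. \<exists>Us. (\<forall>U \<in> set Us. irreducible_rep G U) \<and>
     rep_iso G V (direct_sum_rep Us) \<and> m = length (filter (\<lambda>U. U \<in> \<rho>) Us))"

definition transition :: "('g, 'b) monoid_scheme \<Rightarrow> 'g rep \<Rightarrow> 'g rep set \<Rightarrow> 'g rep set \<Rightarrow> real" where
  "transition G \<eta> \<mu> \<rho> =
     real (irr_dim \<rho>) * real (multiplicity_in G \<rho> (tensor_rep (representative \<mu>) \<eta>))
       / (real (irr_dim \<mu>) * real (fst \<eta>))"

primrec transition_steps ::
  "('g, 'b) monoid_scheme \<Rightarrow> 'g rep \<Rightarrow> nat \<Rightarrow> 'g rep set \<Rightarrow> 'g rep set \<Rightarrow> real" where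
  "transition_steps G \<eta> 0 \<mu> \<rho> = (if \<mu> = \<rho> then 1 else 0)"
| "transition_steps G \<eta> (Suc r) \<mu> \<rho> =
     (\<Sum>\<sigma> \<in> Irr G. transition_steps G \<eta> r \<mu> \<sigma> * transition G \<eta> \<sigma> \<rho>)"

definition plancherel :: "('g, 'b) monoid_scheme \<Rightarrow> 'g rep set \<Rightarrow> real" where
  "plancherel G \<mu> = (real (irr_dim \<mu>))\<^sup>2 / real (order G)"

definition subspace_dim :: "nat \<Rightarrow> 'f::field vec set \<Rightarrow> nat" where
  "subspace_dim n W = vectorspace.dim class_ring ((module_vec TYPE('f) n)\<lparr>carrier := W\<rparr>)"

definition fixed_space :: "nat \<Rightarrow> 'f::field mat \<Rightarrow> 'f vec set" where
  "fixed_space n g = {v \<in> carrier_vec n. g *\<^sub>v v = v}"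

definition fixed_dim :: "nat \<Rightarrow> 'f::field mat \<Rightarrow> nat" where
  "fixed_dim n g = subspace_dim n (fixed_space n g)"

definition prob_span_dim :: "'f::{field,finite} itself \<Rightarrow> nat \<Rightarrow> nat \<Rightarrow> nat \<Rightarrow> real" where
  "prob_span_dim ty a r n =
     measure_pmf.prob (replicate_pmf r (pmf_of_set (carrier_vec n :: 'f vec set)))
       {vs. subspace_dim n (LinearCombinations.module.span class_ring (module_vec TYPE('f) n) (set vs)) = a}"

definition fixing_subgroup :: "'f::field itself \<Rightarrow> nat \<Rightarrow> nat \<Rightarrow> 'f mat set" where
  "fixing_subgroup ty n k = {g \<in> carrier (GL ty n). \<forall>i<k. g *\<^sub>v unit_vec n i = unit_vec n i}"

definition c_coeff :: "nat \<Rightarrow> nat \<Rightarrow> 'f::field mat rep set \<Rightarrow> complex" where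
  "c_coeff n k \<Lambda> = (\<Sum>g \<in> fixing_subgroup TYPE('f) n k. irr_character \<Lambda> g)"


text \<open>The permutation representation on the \<open>q\<^sup>n\<close> vectors. The lemmas below show that it is a
  representation with character \<open>g \<mapsto> q ^ fixed_dim n g\<close>; a representation with this
  character is unique up to isomorphism.\<close>

definition vec_enum :: "nat \<Rightarrow> 'f::{field,finite} vec list" where
  "vec_enum n = (SOME vs. distinct vs \<and> set vs = carrier_vec n)"

definition perm_rep :: "nat \<Rightarrow> 'f::{field,finite} mat rep" where
  "perm_rep n = (length (vec_enum n :: 'f vec list),
     \<lambda>g. let N = length (vec_enum n :: 'f vec list) in
       mat N N (\<lambda>(i, j). if g *\<^sub>v (vec_enum n ! j) = vec_enum n ! i then 1 else 0))"

lemma finite_carrier_vec': "finite (carrier_vec n :: 'f::finite vec set)"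
proof -
  have "(carrier_vec n :: 'f vec set) \<subseteq> vec_of_list ` {xs. set xs \<subseteq> UNIV \<and> length xs = n}"
  proof
    fix v :: "'f vec" assume "v \<in> carrier_vec n"
    then have "v = vec_of_list (list_of_vec v)" "length (list_of_vec v) = n"
      by (simp_all add: vec_list)
    then show "v \<in> vec_of_list ` {xs. set xs \<subseteq> UNIV \<and> length xs = n}" by blast
  qed
  then show ?thesis
    by (rule finite_subset) (intro finite_imageI finite_lists_length_eq finite)
qed

lemma vec_enum: "distinct (vec_enum n :: 'f::{field,finite} vec list)"
  "set (vec_enum n :: 'f vec list) = carrier_vec n"
proof -
  obtain vs :: "'f vec list" where "set vs = carrier_vec n" "distinct vs"
    using finite_distinct_list[OF finite_carrier_vec'] by blast
  then have "distinct vs \<and> set vs = carrier_vec n" by simp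
  then have "distinct (vec_enum n :: 'f vec list) \<and> set (vec_enum n :: 'f vec list) = carrier_vec n"
    unfolding vec_enum_def by (rule someI)
  then show "distinct (vec_enum n :: 'f vec list)"
    "set (vec_enum n :: 'f vec list) = carrier_vec n" by auto
qed

lemma GL_carrier: "g \<in> carrier (GL TYPE('a::semiring_1) n) \<longleftrightarrow>
    g \<in> carrier_mat n n \<and> (\<exists>h \<in> carrier_mat n n. h * g = 1\<^sub>m n \<and> g * h = 1\<^sub>m n)"
  unfolding GL_def units_of_def Units_def by (simp add: ring_mat_simps)

lemma GL_mult: "mult (GL TYPE('a::semiring_1) n) = (*)"
  by (simp add: GL_def units_of_def ring_mat_simps)

lemma vec_enum_nth:
  "j < length (vec_enum n :: 'f::{field,finite} vec list) \<Longrightarrow> (vec_enum n ! j :: 'f vec) \<in> carrier_vec n"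
  by (metis nth_mem vec_enum(2))

lemma vec_enum_nth_eq:
  assumes "i < length (vec_enum n :: 'f::{field,finite} vec list)"
    and "j < length (vec_enum n :: 'f::{field,finite} vec list)"
  shows "(vec_enum n ! i :: 'f vec) = vec_enum n ! j \<longleftrightarrow> i = j"
  using assms by (intro nth_eq_iff_index_eq vec_enum)

lemma perm_rep_carrier:
  "snd (perm_rep n) (g :: 'f::{field,finite} mat)
    \<in> carrier_mat (fst (perm_rep n :: 'f mat rep)) (fst (perm_rep n :: 'f mat rep))"
  by (simp add: perm_rep_def Let_def)

lemma perm_rep_index:
  assumes "i < fst (perm_rep n :: 'f::{field,finite} mat rep)" "j < fst (perm_rep n :: 'f mat rep)"
  shows "snd (perm_rep n) (g :: 'f mat) $$ (i, j) = (if g *\<^sub>v (vec_enum n ! j) = vec_enum n ! i then 1 else 0)"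
  using assms by (simp add: perm_rep_def Let_def)

lemma perm_rep_mult:
  assumes g: "g \<in> carrier_mat n n" and h: "(h :: 'f::{field,finite} mat) \<in> carrier_mat n n"
  shows "snd (perm_rep n) (g * h) = snd (perm_rep n) g * snd (perm_rep n) h"
proof -
  define L where "L = (vec_enum n :: 'f vec list)"
  define N where "N = fst (perm_rep n :: 'f mat rep)"
  define P where "P = (snd (perm_rep n) :: 'f mat \<Rightarrow> complex mat)"
  have N: "N = length L" by (simp add: N_def L_def perm_rep_def)
  have car: "P x \<in> carrier_mat N N" for x unfolding P_def N_def by (rule perm_rep_carrier)
  have ind: "P x $$ (i, j) = (if x *\<^sub>v L ! j = L ! i then 1 else 0)" if "i < N" "j < N" for x i j
    using that unfolding P_def N_def L_def by (rule perm_rep_index)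
  have "P (g * h) $$ (i, j) = (\<Sum>k<N. P g $$ (i, k) * P h $$ (k, j))"
    if i: "i < N" and j: "j < N" for i j
  proof -
    have Lj: "L ! j \<in> carrier_vec n" using j unfolding N L_def by (rule vec_enum_nth)
    then have "h *\<^sub>v L ! j \<in> set L" using h unfolding L_def vec_enum(2) by simp
    then obtain k where k: "k < N" "L ! k = h *\<^sub>v L ! j"
      unfolding N in_set_conv_nth by blast
    have eq: "P h $$ (k', j) = (if k' = k then 1 else 0)" if "k' < N" for k'
      using vec_enum_nth_eq[OF k(1)[unfolded N L_def] that[unfolded N L_def]]
      unfolding ind[OF that j] k(2)[symmetric] unfolding L_def by auto
    have "(\<Sum>k'<N. P g $$ (i, k') * P h $$ (k', j)) = (\<Sum>k'<N. if k' = k then P g $$ (i, k') else 0)"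
      by (rule sum.cong) (simp_all add: eq)
    also have "\<dots> = P g $$ (i, k)" using k(1) by simp
    also have "\<dots> = P (g * h) $$ (i, j)"
      unfolding ind[OF i k(1)] ind[OF i j] k(2) assoc_mult_mat_vec[OF g h Lj] by simp
    finally show ?thesis by simp
  qed
  moreover have "(P g * P h) $$ (i, j) = (\<Sum>k<N. P g $$ (i, k) * P h $$ (k, j))"
    if "i < N" "j < N" for i j
    using that car[of g] car[of h] by (simp add: scalar_prod_def atLeast0LessThan)
  ultimately have "P (g * h) = P g * P h"
    using car[of g] car[of h] car[of "g * h"] by (intro eq_matI) simp_all
  then show ?thesis unfolding P_def .
qed

lemma perm_rep_one: "snd (perm_rep n) (1\<^sub>m n :: 'f::{field,finite} mat) = 1\<^sub>m (fst (perm_rep n :: 'f mat rep))"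
proof (rule eq_matI)
  fix i j assume "i < dim_row (1\<^sub>m (fst (perm_rep n :: 'f mat rep)) :: complex mat)"
    and "j < dim_col (1\<^sub>m (fst (perm_rep n :: 'f mat rep)) :: complex mat)"
  then have ij: "i < fst (perm_rep n :: 'f mat rep)" "j < fst (perm_rep n :: 'f mat rep)" by auto
  then have l: "i < length (vec_enum n :: 'f vec list)" "j < length (vec_enum n :: 'f vec list)"
    by (simp_all add: perm_rep_def)
  show "snd (perm_rep n) (1\<^sub>m n :: 'f mat) $$ (i, j) = 1\<^sub>m (fst (perm_rep n :: 'f mat rep)) $$ (i, j)"
    unfolding perm_rep_index[OF ij] one_mult_mat_vec[OF vec_enum_nth[OF l(2)]]
      vec_enum_nth_eq[OF l(2) l(1)] using ij by auto
qed (use perm_rep_carrier[of n "1\<^sub>m n :: 'f mat"] in auto)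

lemma is_rep_perm_rep: "is_rep (GL TYPE('f::{field,finite}) n) (perm_rep n)"
proof -
  let ?P = "snd (perm_rep n) :: 'f mat \<Rightarrow> complex mat"
  let ?N = "fst (perm_rep n :: 'f mat rep)"
  have car: "?P g \<in> carrier_mat ?N ?N" for g by (rule perm_rep_carrier)
  have "?P g \<in> carrier (GL TYPE(complex) ?N)" if "g \<in> carrier (GL TYPE('f) n)" for g
  proof -
    from that obtain h where "g \<in> carrier_mat n n" "h \<in> carrier_mat n n" "h * g = 1\<^sub>m n" "g * h = 1\<^sub>m n"
      by (auto simp: GL_carrier)
    then have "?P h * ?P g = 1\<^sub>m ?N" "?P g * ?P h = 1\<^sub>m ?N"
      by (simp_all add: perm_rep_mult[symmetric] perm_rep_one)
    then show ?thesis using car by (auto simp: GL_carrier)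
  qed
  then show ?thesis
    by (auto simp: is_rep_def hom_def GL_mult GL_carrier perm_rep_mult)
qed

lemma card_vectorspace:
  fixes V :: "('f::{field,finite}, 'v, 'b) module_scheme"
  assumes V: "vectorspace class_ring V" and fin: "finite (carrier V)"
  shows "card (carrier V) = CARD('f) ^ vectorspace.dim class_ring V"
proof -
  interpret V: vectorspace "class_ring :: 'f ring" V by fact
  have "carrier V = V.span (carrier V)"
    using V.in_own_span[of "carrier V"] V.span_is_subset2[of "carrier V"] by blast
  then have "V.fin_dim"
    unfolding V.fin_dim_def using fin by blast
  then obtain B where B: "finite B" "V.basis B" using V.finite_basis_exists by blast
  then have li: "V.lin_indpt B" and gen: "V.gen_set B" and sub: "B \<subseteq> carrier V"
    by (auto simp: V.basis_def)
  have dim: "V.dim = card B" using V.dim_basis[OF B] .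
  have uniq: "\<exists>!a. a \<in> B \<rightarrow>\<^sub>E UNIV \<and> V.lincomb a B = v" if "v \<in> carrier V" for v
    using V.basis_criterion[OF B(1) sub] B(2) that by simp
  have clo: "V.lincomb a B \<in> carrier V" for a
    using sub by (intro V.lincomb_closed) auto
  have "bij_betw (\<lambda>a. V.lincomb a B) (B \<rightarrow>\<^sub>E UNIV) (carrier V)"
  proof (rule bij_betwI')
    show "(V.lincomb a B = V.lincomb b B) = (a = b)"
      if "a \<in> B \<rightarrow>\<^sub>E UNIV" "b \<in> B \<rightarrow>\<^sub>E UNIV" for a b
      using uniq[OF clo[of b]] that by auto
    show "V.lincomb a B \<in> carrier V" for a by (rule clo)
    show "\<exists>a\<in>B \<rightarrow>\<^sub>E UNIV. v = V.lincomb a B" if "v \<in> carrier V" for v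
      using uniq[OF that] by auto
  qed
  from bij_betw_same_card[OF this] show ?thesis
    using B(1) dim by (simp add: card_PiE)
qed

lemma character_perm_rep:
  assumes g: "g \<in> carrier (GL TYPE('f::{field,finite}) n)"
  shows "character (perm_rep n) g = of_nat (CARD('f) ^ fixed_dim n g)"
proof -
  let ?L = "vec_enum n :: 'f vec list"
  let ?N = "length ?L"
  let ?V = "module_vec TYPE('f) n"
  have gc: "g \<in> carrier_mat n n" using g by (auto simp: GL_carrier)
  have mod: "Module.module (class_ring :: 'f ring) ?V"
    using vec_vs[where ?'a='f] by (simp add: vectorspace_def)
  have "VectorSpace.subspace class_ring (fixed_space n g) ?V"
    unfolding VectorSpace.subspace_def submodule_def
    using gc mod vec_vs[where ?'a='f] 
    by (auto simp: fixed_space_def module_vec_simps mult_add_distrib_mat_vec mult_mat_vec)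
  then have vs: "vectorspace class_ring (?V\<lparr>carrier := fixed_space n g\<rparr>)"
    by (rule vectorspace.subspace_is_vs[OF vec_vs])
  have fin: "finite (fixed_space n g)"
    by (rule finite_subset[OF _ finite_carrier_vec'[of n]]) (auto simp: fixed_space_def)
  have "fixed_space n g = (!) ?L ` {i \<in> {..<?N}. g *\<^sub>v ?L ! i = ?L ! i}"
    using vec_enum(2)[of n, where ?'f='f] by (auto simp: fixed_space_def set_conv_nth)
  moreover have "inj_on ((!) ?L) {i \<in> {..<?N}. g *\<^sub>v ?L ! i = ?L ! i}"
    using inj_on_nth[OF vec_enum(1)] by (auto simp: inj_on_def nth_eq_iff_index_eq[OF vec_enum(1)])
  ultimately have "card (fixed_space n g) = card {i \<in> {..<?N}. g *\<^sub>v ?L ! i = ?L ! i}"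
    by (simp add: card_image)
  moreover have "character (perm_rep n) g = of_nat (card {i \<in> {..<?N}. g *\<^sub>v ?L ! i = ?L ! i})"
    by (simp add: character_def perm_rep_def Let_def sum.If_cases Int_def)
  moreover have "card (fixed_space n g) = CARD('f) ^ fixed_dim n g"
    using card_vectorspace[OF vs] fin by (simp add: fixed_dim_def subspace_dim_def)
  ultimately show ?thesis by simp
qed

end

theory Submission
  imports Defs "Jordan_Normal_Form.Spectral_Radius"
begin

text \<open>Both sides are computed as one average over \<open>G = GL(n,q)\<close>, namely
  \<open>(1 / d\<^sub>\<Lambda>) \<Sum>\<^sub>g (q ^ d(g) / q ^ n) ^ r \<chi>\<^sup>\<Lambda>(g)\<close>.

Left-hand side. For any finite group, dividing the law of the chain after \<open>r\<close> steps by dimensions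
turns it into the coefficients of a class function: \<open>\<Sum>\<^sub>\<sigma> (K\<^sup>r(1,\<sigma>) / d\<^sub>\<sigma>) \<chi>\<^sup>\<sigma> = (\<chi>\<^sup>\<eta> / d\<^sub>\<eta>) ^ r\<close>. One step of
the chain multiplies this function by \<open>\<chi>\<^sup>\<eta> / d\<^sub>\<eta>\<close>, because the factors \<open>d\<^sub>\<rho> / d\<^sub>\<sigma>\<close> of the kernel cancel
and \<open>\<Sum>\<^sub>\<rho> m\<^sub>\<rho>(\<sigma> \<otimes> \<eta>) \<chi>\<^sup>\<rho> = \<chi>\<^sup>\<sigma> \<chi>\<^sup>\<eta>\<close> (\<open>transition_steps_generating\<close>). Orthonormality of the irreducible
characters reads off the coefficient of \<open>\<Lambda>\<close> (\<open>transition_steps_over_plancherel\<close>). This rests on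
complete reducibility, Schur's lemma, the orthogonality relations and finiteness of \<open>Irr G\<close>, all
proved here for matrix representations. The pairing used throughout is bilinear, with \<open>g\<^sup>-\<^sup>1\<close> in place of
complex conjugation; \<open>g\<close> and \<open>g\<^sup>-\<^sup>1\<close> fix the same vectors, so the inverse disappears at the end.

Right-hand side. The number \<open>(q ^ d(g) / q ^ n) ^ r\<close> is the probability that \<open>g\<close> fixes all of \<open>r\<close> random
vectors. Exchanging the sum over \<open>g\<close> with the sum over tuples of vectors leaves, for each tuple, the
sum of \<open>\<chi>\<^sup>\<Lambda>\<close> over the pointwise stabiliser of its span. If the span has dimension \<open>a\<close>, a basis adapted
to it (\<open>adapted_basis\<close>) conjugates that stabiliser to the group fixing the first \<open>a\<close> unit vectors,
so the sum is \<open>c\<^sub>a(\<Lambda>)\<close> (\<open>sum_pointwise_stabilizer\<close>). Grouping the tuples by \<open>a\<close> gives the formula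
(\<open>sum_prob_span_dim\<close>).\<close>

(* Indexing with $ refers to vectors of variable length only. *)
unbundle no vec_syntax

section \<open>Adapted bases\<close>

definition linear_subset :: "nat \<Rightarrow> 'a::field vec set \<Rightarrow> bool" where
  "linear_subset n W \<longleftrightarrow> W \<subseteq> carrier_vec n \<and> 0\<^sub>v n \<in> W \<and>
     (\<forall>v \<in> W. \<forall>w \<in> W. v + w \<in> W) \<and> (\<forall>c. \<forall>v \<in> W. c \<cdot>\<^sub>v v \<in> W)"

lemma subspace_module_vec_iff:
  "VectorSpace.subspace class_ring W (module_vec TYPE('a::field) n) \<longleftrightarrow> linear_subset n W"
proof -
  have mod: "Module.module (class_ring :: 'a ring) (module_vec TYPE('a) n)"
    using vec_vs[where ?'a='a] by (simp add: vectorspace_def)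
  show ?thesis
    unfolding VectorSpace.subspace_def submodule_def linear_subset_def
    using mod vec_vs[where ?'a='a and n=n] by (auto simp: module_vec_simps)
qed

lemma index_mult_mat_vec_sum:
  assumes "A \<in> carrier_mat n m" "v \<in> carrier_vec m" "i < n"
  shows "(A *\<^sub>v v) $ i = (\<Sum>j<m. A $$ (i, j) * v $ j)"
  using assms by (auto simp: scalar_prod_def atLeast0LessThan intro!: sum.cong)

lemma index_mult_mat_sum:
  assumes "A \<in> carrier_mat n m" "B \<in> carrier_mat m l" "i < n" "j < l"
  shows "(A * B) $$ (i, j) = (\<Sum>k<m. A $$ (i, k) * B $$ (k, j))"
  using assms by (auto simp: scalar_prod_def atLeast0LessThan intro!: sum.cong)

lemma col_eq_mult_unit_vec:
  "A \<in> carrier_mat n m \<Longrightarrow> j < m \<Longrightarrow> col A j = A *\<^sub>v unit_vec m j" for A :: "'a::semiring_1 mat"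
  by (intro eq_vecI) auto

lemma inverse_mat_of_trivial_kernel:
  assumes A: "(A :: 'a::field mat) \<in> carrier_mat n n"
    and ker: "\<And>x. x \<in> carrier_vec n \<Longrightarrow> A *\<^sub>v x = 0\<^sub>v n \<Longrightarrow> x = 0\<^sub>v n"
  obtains B where "B \<in> carrier_mat n n" "A * B = 1\<^sub>m n" "B * A = 1\<^sub>m n"
proof -
  have "det A \<noteq> 0" using ker by (auto simp: det_0_iff_vec_prod_zero_field[OF A])
  from det_non_zero_imp_unit[OF A this, of "()"] show ?thesis
    using that by (auto simp: Units_def ring_mat_simps)
qed

lemma mult_mat_vec_cancel:
  assumes "(A :: 'a::field mat) \<in> carrier_mat n m" "B \<in> carrier_mat m n" "B * A = 1\<^sub>m m" "v \<in> carrier_vec m"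
  shows "B *\<^sub>v (A *\<^sub>v v) = v"
  using assms by (metis assoc_mult_mat_vec one_mult_mat_vec)

text \<open>The matrix \<open>E\<close> has \<open>u\<close> as column \<open>k\<close>, the unit vector \<open>e\<^sub>k\<close> as column \<open>j\<close>, and unit vectors elsewhere.
It is invertible because \<open>u\<^sub>j \<noteq> 0\<close>. Multiplying a change of basis by \<open>E\<close> leaves its first \<open>k\<close> basis vectors
in place and makes the vector with coordinates \<open>u\<close> the next one.\<close>

lemma adapted_basis_step:
  fixes u :: "'a::field vec"
  assumes u: "u \<in> carrier_vec n" and j: "k \<le> j" "j < n" "u $ j \<noteq> 0"
  obtains E F where "E \<in> carrier_mat n n" "F \<in> carrier_mat n n" "E * F = 1\<^sub>m n" "F * E = 1\<^sub>m n"
    "\<And>x. x \<in> carrier_vec n \<Longrightarrow> (\<forall>i. k < i \<and> i < n \<longrightarrow> x $ i = 0) \<Longrightarrow>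
       E *\<^sub>v x = vec n (\<lambda>i. if i < k then x $ i else 0) + x $ k \<cdot>\<^sub>v u"
proof -
  have k: "k < n" using j by simp
  define E where "E = mat n n (\<lambda>(i, c). if c = k then u $ i
    else if c = j then (if i = k then 1 else 0) else if i = c then 1 else 0)"
  have E: "E \<in> carrier_mat n n" by (simp add: E_def)
  have ind: "(E *\<^sub>v x) $ i = u $ i * x $ k + (if j \<noteq> k \<and> i = k then x $ j else 0)
      + (if i \<noteq> k \<and> i \<noteq> j then x $ i else 0)"
    if x: "x \<in> carrier_vec n" and i: "i < n" for x i
  proof -
    have "(E *\<^sub>v x) $ i = (\<Sum>c<n. E $$ (i, c) * x $ c)"
      by (rule index_mult_mat_vec_sum[OF E x i])
    also have "\<dots> = (\<Sum>c<n. (if c = k then u $ i * x $ k else 0)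
        + (if c = j then (if j \<noteq> k \<and> i = k then x $ j else 0) else 0)
        + (if c = i then (if i \<noteq> k \<and> i \<noteq> j then x $ i else 0) else 0))"
      using i by (intro sum.cong) (auto simp: E_def)
    also have "\<dots> = u $ i * x $ k + (if j \<noteq> k \<and> i = k then x $ j else 0)
      + (if i \<noteq> k \<and> i \<noteq> j then x $ i else 0)"
      using i j k by (simp add: sum.distrib)
    finally show ?thesis .
  qed
  have ker: "x = 0\<^sub>v n" if x: "x \<in> carrier_vec n" and 0: "E *\<^sub>v x = 0\<^sub>v n" for x
  proof -
    have eq: "u $ i * x $ k + (if j \<noteq> k \<and> i = k then x $ j else 0)
      + (if i \<noteq> k \<and> i \<noteq> j then x $ i else 0) = 0" if "i < n" for i
      using ind[OF x that] 0 that by simp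
    have xk: "x $ k = 0" using eq[OF j(2)] j by (cases "j = k") auto
    have "x $ i = 0" if "i < n" for i
      using eq[OF that] eq[OF k] xk by (cases "i = j"; cases "i = k"; auto split: if_splits)
    then show ?thesis using x by (intro eq_vecI) auto
  qed
  obtain F where F: "F \<in> carrier_mat n n" "E * F = 1\<^sub>m n" "F * E = 1\<^sub>m n"
    using inverse_mat_of_trivial_kernel[OF E ker] by blast
  show thesis
  proof (rule that[OF E F])
    fix x :: "'a vec" assume x: "x \<in> carrier_vec n" and z: "\<forall>i. k < i \<and> i < n \<longrightarrow> x $ i = 0"
    show "E *\<^sub>v x = vec n (\<lambda>i. if i < k then x $ i else 0) + x $ k \<cdot>\<^sub>v u"
    proof (rule eq_vecI)
      fix i assume "i < dim_vec (vec n (\<lambda>i. if i < k then x $ i else 0) + x $ k \<cdot>\<^sub>v u)"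
      then have i: "i < n" using u by simp
      show "(E *\<^sub>v x) $ i = (vec n (\<lambda>i. if i < k then x $ i else 0) + x $ k \<cdot>\<^sub>v u) $ i"
        unfolding ind[OF x i] using u i z j by auto
    qed (use E u in auto)
  qed
qed

text \<open>Take a basis of the whole space whose first \<open>k\<close> members lie in \<open>W\<close>, with \<open>k\<close> as large as possible. If some
\<open>w \<in> W\<close> had a nonzero coordinate beyond the first \<open>k\<close>, then \<open>w\<close> could be exchanged into position \<open>k\<close>.
The columns of \<open>S\<close> are the basis and \<open>T\<close> computes coordinates. The lemma serves twice: over the
complex numbers to split representations, and over the finite field to bring a span into
standard position.\<close>

lemma adapted_basis:
  fixes W :: "'a::field vec set"
  assumes W: "linear_subset n W"
  obtains S T k where "S \<in> carrier_mat n n" "T \<in> carrier_mat n n" "S * T = 1\<^sub>m n" "T * S = 1\<^sub>m n"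
    "k \<le> n" "W = {v \<in> carrier_vec n. \<forall>i. k \<le> i \<and> i < n \<longrightarrow> (T *\<^sub>v v) $ i = 0}"
proof -
  let ?Z = "\<lambda>(T :: 'a mat) k. {v \<in> carrier_vec n. \<forall>i. k \<le> i \<and> i < n \<longrightarrow> (T *\<^sub>v v) $ i = 0}"
  define P where "P k \<longleftrightarrow> k \<le> n \<and> (\<exists>S T. S \<in> carrier_mat n n \<and> T \<in> carrier_mat n n \<and>
    S * T = 1\<^sub>m n \<and> T * S = 1\<^sub>m n \<and> ?Z T k \<subseteq> W)" for k
  have P0: "P 0"
  proof -
    have "v = 0\<^sub>v n" if "v \<in> ?Z (1\<^sub>m n) 0" for v :: "'a vec"
    proof (rule eq_vecI)
      fix i assume "i < dim_vec (0\<^sub>v n :: 'a vec)"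
      with that have "(1\<^sub>m n *\<^sub>v v) $ i = 0" "i < n" "v \<in> carrier_vec n" by auto
      then show "v $ i = 0\<^sub>v n $ i" by (simp add: one_mult_mat_vec del: index_mult_mat_vec)
    qed (use that in auto)
    then have "?Z (1\<^sub>m n) 0 \<subseteq> {0\<^sub>v n}" by blast
    also have "\<dots> \<subseteq> W" using W by (simp add: linear_subset_def)
    finally show ?thesis unfolding P_def by (intro conjI exI[of _ "1\<^sub>m n"]) auto
  qed
  have bd: "\<forall>k. P k \<longrightarrow> k \<le> n" by (simp add: P_def)
  define k where "k = (GREATEST k. P k)"
  have Pk: "P k" unfolding k_def by (rule GreatestI_nat[of P, OF P0]) (use bd in auto)
  have max: "k' \<le> k" if "P k'" for k'
    unfolding k_def by (rule Greatest_le_nat[of P, OF that]) (use bd in auto)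
  from Pk obtain S T where S: "S \<in> carrier_mat n n" and T: "T \<in> carrier_mat n n"
    and ST: "S * T = 1\<^sub>m n" and TS: "T * S = 1\<^sub>m n" and sub: "?Z T k \<subseteq> W" and kn: "k \<le> n"
    unfolding P_def by blast
  have "W \<subseteq> ?Z T k"
  proof (rule ccontr)
    assume "\<not> W \<subseteq> ?Z T k"
    then obtain w j where w: "w \<in> W" and j: "k \<le> j" "j < n" "(T *\<^sub>v w) $ j \<noteq> 0"
      using W unfolding linear_subset_def by blast
    have wc: "w \<in> carrier_vec n" using w W by (auto simp: linear_subset_def)
    have Twc: "T *\<^sub>v w \<in> carrier_vec n" using T wc by simp
    obtain E F where E: "E \<in> carrier_mat n n" and F: "F \<in> carrier_mat n n"
      and EF: "E * F = 1\<^sub>m n" and FE: "F * E = 1\<^sub>m n"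
      and Ex: "\<And>x. x \<in> carrier_vec n \<Longrightarrow> (\<forall>i. k < i \<and> i < n \<longrightarrow> x $ i = 0) \<Longrightarrow>
       E *\<^sub>v x = vec n (\<lambda>i. if i < k then x $ i else 0) + x $ k \<cdot>\<^sub>v (T *\<^sub>v w)"
      using adapted_basis_step[OF Twc j] by blast
    have i1: "(S * E) * (F * T) = 1\<^sub>m n"
    proof -
      have "(S * E) * (F * T) = S * ((E * F) * T)" using S E F T by (simp add: assoc_mult_mat[of _ n n _ n _ n])
      then show ?thesis using EF ST S T by simp
    qed
    have i2: "(F * T) * (S * E) = 1\<^sub>m n"
    proof -
      have "(F * T) * (S * E) = F * ((T * S) * E)" using S E F T by (simp add: assoc_mult_mat[of _ n n _ n _ n])
      then show ?thesis using FE TS F E by simp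
    qed
    have "?Z (F * T) (Suc k) \<subseteq> W"
    proof
      fix v assume v: "v \<in> ?Z (F * T) (Suc k)"
      then have vc: "v \<in> carrier_vec n" by simp
      define x where "x = (F * T) *\<^sub>v v"
      have x: "x \<in> carrier_vec n" using F T vc by (simp add: x_def)
      define y where "y = vec n (\<lambda>i. if i < k then x $ i else 0)"
      have y: "y \<in> carrier_vec n" by (simp add: y_def)
      have xz: "\<forall>i. k < i \<and> i < n \<longrightarrow> x $ i = 0" using v by (auto simp: x_def)
      have "v = (S * E) *\<^sub>v x"
        unfolding x_def by (rule mult_mat_vec_cancel[OF _ _ i1 vc, symmetric]) (use S E F T in auto)
      also have "\<dots> = S *\<^sub>v (E *\<^sub>v x)" using S E x by simp
      also have "\<dots> = S *\<^sub>v (y + x $ k \<cdot>\<^sub>v (T *\<^sub>v w))" using Ex[OF x xz] by (simp add: y_def)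
      also have "\<dots> = S *\<^sub>v y + x $ k \<cdot>\<^sub>v (S *\<^sub>v (T *\<^sub>v w))"
        using S y Twc by (simp add: mult_add_distrib_mat_vec mult_mat_vec)
      also have "S *\<^sub>v (T *\<^sub>v w) = w" by (rule mult_mat_vec_cancel[OF T S ST wc])
      finally have veq: "v = S *\<^sub>v y + x $ k \<cdot>\<^sub>v w" .
      have "S *\<^sub>v y \<in> ?Z T k"
        using mult_mat_vec_cancel[OF S T TS y] S y by (auto simp: y_def)
      then show "v \<in> W" unfolding veq using sub W w unfolding linear_subset_def by blast
    qed
    then have "P (Suc k)" unfolding P_def using i1 i2 S E F T j
      by (intro conjI exI[of _ "S * E"] exI[of _ "F * T"]) auto
    then show False using max by fastforce
  qed
  with sub that S T ST TS kn show thesis by blast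
qed

text \<open>Padding \<open>A\<close> with zero columns and \<open>B\<close> with zero rows to square matrices preserves the product, and a
square matrix with a zero column has no inverse. Applied in both directions, the lemma shows that
invertible matrices are square.\<close>

lemma card_le_of_right_inverse:
  fixes A B :: "'a::field mat"
  assumes A: "A \<in> carrier_mat n m" and B: "B \<in> carrier_mat m n" and AB: "A * B = 1\<^sub>m n"
  shows "n \<le> m"
proof (rule ccontr)
  assume "\<not> n \<le> m"
  then have mn: "m < n" by simp
  define A' where "A' = mat n n (\<lambda>(i, j). if j < m then A $$ (i, j) else 0)"
  define B' where "B' = mat n n (\<lambda>(i, j). if i < m then B $$ (i, j) else 0)"
  have A': "A' \<in> carrier_mat n n" and B': "B' \<in> carrier_mat n n" by (simp_all add: A'_def B'_def)
  have "A' * B' = 1\<^sub>m n"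
  proof (rule eq_matI)
    fix i j assume ij: "i < dim_row (1\<^sub>m n :: 'a mat)" "j < dim_col (1\<^sub>m n :: 'a mat)"
    then have "(A' * B') $$ (i, j) = (\<Sum>k<n. A' $$ (i, k) * B' $$ (k, j))"
      by (intro index_mult_mat_sum[OF A' B']) auto
    also have "\<dots> = (\<Sum>k<m. A $$ (i, k) * B $$ (k, j))"
      using ij mn by (intro sum.mono_neutral_cong_right) (auto simp: A'_def B'_def)
    also have "\<dots> = (A * B) $$ (i, j)" using ij by (intro index_mult_mat_sum[OF A B, symmetric]) auto
    finally show "(A' * B') $$ (i, j) = 1\<^sub>m n $$ (i, j)" by (simp add: AB)
  qed (use A' B' in auto)
  then have "B' * A' = 1\<^sub>m n" using mat_mult_left_right_inverse[OF A' B'] by simp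
  moreover have "(B' * A') $$ (m, m) = (\<Sum>k<n. B' $$ (m, k) * A' $$ (k, m))"
    using mn by (intro index_mult_mat_sum[OF B' A']) auto
  ultimately show False using mn by (simp add: A'_def)
qed

lemma linear_subset_kernel:
  "T \<in> carrier_mat m n \<Longrightarrow> linear_subset n {v \<in> carrier_vec n. T *\<^sub>v v = 0\<^sub>v m}"
  for T :: "'a::field mat"
  by (auto simp: linear_subset_def mult_add_distrib_mat_vec mult_mat_vec)

lemma linear_subset_image:
  fixes T :: "'a::field mat"
  assumes T: "T \<in> carrier_mat m n"
  shows "linear_subset m ((*\<^sub>v) T ` carrier_vec n)"
  unfolding linear_subset_def
proof (intro conjI ballI allI)
  show "(*\<^sub>v) T ` carrier_vec n \<subseteq> carrier_vec m" using T by auto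
  have "T *\<^sub>v 0\<^sub>v n = 0\<^sub>v m" using T by (intro eq_vecI) auto
  then show "0\<^sub>v m \<in> (*\<^sub>v) T ` carrier_vec n" by (metis image_eqI zero_carrier_vec)
  show "v + w \<in> (*\<^sub>v) T ` carrier_vec n" if "v \<in> (*\<^sub>v) T ` carrier_vec n" "w \<in> (*\<^sub>v) T ` carrier_vec n" for v w
    using that T by (auto simp: mult_add_distrib_mat_vec[symmetric])
  show "c \<cdot>\<^sub>v v \<in> (*\<^sub>v) T ` carrier_vec n" if "v \<in> (*\<^sub>v) T ` carrier_vec n" for v c
    using that T by (auto simp: mult_mat_vec[symmetric])
qed

section \<open>Block, Kronecker and summed matrices\<close>

lemma four_block_mat_eqD:
  assumes eq: "four_block_mat A B C D = four_block_mat A' B' C' D'"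
    and car: "A \<in> carrier_mat a b" "B \<in> carrier_mat a d" "C \<in> carrier_mat c b" "D \<in> carrier_mat c d"
    "A' \<in> carrier_mat a b" "B' \<in> carrier_mat a d" "C' \<in> carrier_mat c b" "D' \<in> carrier_mat c d"
  shows "A = A'" "B = B'" "C = C'" "D = D'"
proof -
  have e: "four_block_mat A B C D $$ (i, j) = four_block_mat A' B' C' D' $$ (i, j)" for i j
    by (simp add: eq)
  show "A = A'"
  proof (rule eq_matI)
    fix i j assume "i < dim_row A'" "j < dim_col A'" then show "A $$ (i, j) = A' $$ (i, j)"
      using e[of i j] car by simp
  qed (use car in auto)
  show "B = B'"
  proof (rule eq_matI)
    fix i j assume "i < dim_row B'" "j < dim_col B'" then show "B $$ (i, j) = B' $$ (i, j)"
      using e[of i "j + b"] car by simp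
  qed (use car in auto)
  show "C = C'"
  proof (rule eq_matI)
    fix i j assume "i < dim_row C'" "j < dim_col C'" then show "C $$ (i, j) = C' $$ (i, j)"
      using e[of "i + a" j] car by simp
  qed (use car in auto)
  show "D = D'"
  proof (rule eq_matI)
    fix i j assume "i < dim_row D'" "j < dim_col D'" then show "D $$ (i, j) = D' $$ (i, j)"
      using e[of "i + a" "j + b"] car by simp
  qed (use car in auto)
qed

lemma block_diag_mult:
  assumes "(A :: 'a::comm_ring_1 mat) \<in> carrier_mat n n" "D \<in> carrier_mat m m" "A' \<in> carrier_mat n n" "D' \<in> carrier_mat m m"
  shows "four_block_mat A (0\<^sub>m n m) (0\<^sub>m m n) D * four_block_mat A' (0\<^sub>m n m) (0\<^sub>m m n) D'
    = four_block_mat (A * A') (0\<^sub>m n m) (0\<^sub>m m n) (D * D')" 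
  using assms by (subst mult_four_block_mat[of _ n n _ m _ m _ _ n _ m]) auto

lemma sum_lessThan_add: "(\<Sum>i<n + m. f i) = (\<Sum>i<n. f i) + (\<Sum>i<m. f (n + i))"
  for f :: "nat \<Rightarrow> 'b::comm_monoid_add" and n m :: nat
  by (induction m) (simp_all add: add.assoc)

lemma sum_lessThan_mult: "(\<Sum>k<n * m. f (k div m) (k mod m)) = (\<Sum>i<n. \<Sum>j<m. f i j)"
  for f :: "nat \<Rightarrow> nat \<Rightarrow> 'b::comm_monoid_add" and n m :: nat
proof (induction n)
  case (Suc n)
  have "(\<Sum>k<Suc n * m. f (k div m) (k mod m)) = (\<Sum>k<n * m + m. f (k div m) (k mod m))"
    by (simp add: add.commute)
  also have "\<dots> = (\<Sum>k<n * m. f (k div m) (k mod m)) + (\<Sum>j<m. f ((n * m + j) div m) ((n * m + j) mod m))"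
    by (rule sum_lessThan_add)
  also have "(\<Sum>j<m. f ((n * m + j) div m) ((n * m + j) mod m)) = (\<Sum>j<m. f n j)"
    by (intro sum.cong) auto
  finally show ?case using Suc.IH by simp
qed simp

lemma kronecker_product_carrier:
  "A \<in> carrier_mat a b \<Longrightarrow> B \<in> carrier_mat c d \<Longrightarrow> kronecker_product A B \<in> carrier_mat (a * c) (b * d)"
  by (auto simp: kronecker_product_def)

text \<open>A row or column index of a Kronecker product encodes a pair by quotient and remainder, so the
single sum in the product on the right is a double sum, which factors.\<close>

lemma kronecker_product_mult:
  assumes A: "A \<in> carrier_mat n n" and B: "B \<in> carrier_mat m m"
    and A': "A' \<in> carrier_mat n n" and B': "B' \<in> carrier_mat m m"
  shows "kronecker_product (A * A') (B * B') = kronecker_product A B * kronecker_product A' B'"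
proof (rule eq_matI)
  note K = kronecker_product_carrier[OF A B] and K' = kronecker_product_carrier[OF A' B']
  fix i j assume "i < dim_row (kronecker_product A B * kronecker_product A' B')"
    "j < dim_col (kronecker_product A B * kronecker_product A' B')"
  then have i: "i < n * m" and j: "j < n * m" using K K' by auto
  then have m: "m > 0" by (cases m) auto
  have i': "i div m < n" "i mod m < m" and j': "j div m < n" "j mod m < m"
    using i j m by (auto simp: less_mult_imp_div_less)
  have "kronecker_product (A * A') (B * B') $$ (i, j)
      = (A * A') $$ (i div m, j div m) * (B * B') $$ (i mod m, j mod m)"
    using i j A A' B B' by (simp add: kronecker_product_def)
  also have "\<dots> = (\<Sum>k<n. A $$ (i div m, k) * A' $$ (k, j div m)) * (\<Sum>l<m. B $$ (i mod m, l) * B' $$ (l, j mod m))"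
    unfolding index_mult_mat_sum[OF A A' i'(1) j'(1)] index_mult_mat_sum[OF B B' i'(2) j'(2)] ..
  also have "\<dots> = (\<Sum>k<n. \<Sum>l<m. (A $$ (i div m, k) * B $$ (i mod m, l)) * (A' $$ (k, j div m) * B' $$ (l, j mod m)))"
    by (simp add: sum_product mult_ac)
  also have "\<dots> = (\<Sum>p<n * m. (A $$ (i div m, p div m) * B $$ (i mod m, p mod m)) * (A' $$ (p div m, j div m) * B' $$ (p mod m, j mod m)))"
    by (rule sum_lessThan_mult[symmetric])
  also have "\<dots> = (\<Sum>p<n * m. kronecker_product A B $$ (i, p) * kronecker_product A' B' $$ (p, j))"
    using i j A A' B B' by (intro sum.cong) (auto simp: kronecker_product_def)
  also have "\<dots> = (kronecker_product A B * kronecker_product A' B') $$ (i, j)"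
    by (rule index_mult_mat_sum[OF K K' i j, symmetric])
  finally show "kronecker_product (A * A') (B * B') $$ (i, j) = (kronecker_product A B * kronecker_product A' B') $$ (i, j)" .
qed (use assms in \<open>auto simp: kronecker_product_def\<close>)

lemma kronecker_product_one: "kronecker_product (1\<^sub>m n) (1\<^sub>m m) = 1\<^sub>m (n * m)"
proof (rule eq_matI)
  fix i j assume "i < dim_row (1\<^sub>m (n * m) :: complex mat)" "j < dim_col (1\<^sub>m (n * m) :: complex mat)"
  then have i: "i < n * m" and j: "j < n * m" by auto
  then have m: "m > 0" by (cases m) auto
  have "i div m < n" "i mod m < m" "j div m < n" "j mod m < m"
    using i j m by (auto simp: less_mult_imp_div_less)
  moreover have "i = j \<longleftrightarrow> i div m = j div m \<and> i mod m = j mod m" by (metis div_mult_mod_eq)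
  ultimately show "kronecker_product (1\<^sub>m n) (1\<^sub>m m) $$ (i, j) = 1\<^sub>m (n * m) $$ (i, j)"
    using i j by (auto simp: kronecker_product_def)
qed (auto simp: kronecker_product_def)

text \<open>Trace is invariant under cyclic exchange, hence under conjugation.\<close>

lemma trace_conj_invariant:
  assumes P: "P \<in> carrier_mat n n" and Q: "Q \<in> carrier_mat n n" and QP: "Q * P = 1\<^sub>m n"
    and A: "A \<in> carrier_mat n n" and B: "B \<in> carrier_mat n n" and eq: "P * A = B * P"
  shows "(\<Sum>i<n. A $$ (i, i)) = (\<Sum>i<n. (B :: 'a::field mat) $$ (i, i))"
proof -
  have tr: "(\<Sum>i<n. (X * Y) $$ (i, i)) = (\<Sum>i<n. (Y * X) $$ (i, i))"
    if X: "X \<in> carrier_mat n n" and Y: "Y \<in> carrier_mat n n" for X Y :: "'a mat"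
  proof -
    have "(\<Sum>i<n. (X * Y) $$ (i, i)) = (\<Sum>i<n. \<Sum>k<n. X $$ (i, k) * Y $$ (k, i))"
      by (intro sum.cong index_mult_mat_sum[OF X Y]) auto
    also have "\<dots> = (\<Sum>k<n. \<Sum>i<n. Y $$ (k, i) * X $$ (i, k))"
      by (subst sum.swap) (simp add: mult.commute)
    also have "\<dots> = (\<Sum>i<n. (Y * X) $$ (i, i))"
      by (intro sum.cong index_mult_mat_sum[OF Y X, symmetric]) auto
    finally show ?thesis .
  qed
  have PQ: "P * Q = 1\<^sub>m n" by (rule mat_mult_left_right_inverse[OF Q P QP])
  have "A = Q * (P * A)" using QP Q P A by (metis assoc_mult_mat left_mult_one_mat)
  then have "(\<Sum>i<n. A $$ (i, i)) = (\<Sum>i<n. (Q * (B * P)) $$ (i, i))" using eq by simp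
  also have "\<dots> = (\<Sum>i<n. ((B * P) * Q) $$ (i, i))" using Q B P by (intro tr) auto
  also have "(B * P) * Q = B" using B P Q PQ by simp
  finally show ?thesis .
qed

text \<open>Matrices of all sizes share one type, so an empty sum has no natural size. The dimensions are
therefore arguments, and the sum is taken entrywise.\<close>

definition mat_sum :: "nat \<Rightarrow> nat \<Rightarrow> ('i \<Rightarrow> 'a::comm_ring_1 mat) \<Rightarrow> 'i set \<Rightarrow> 'a mat" where
  "mat_sum n m f I = mat n m (\<lambda>(i, j). \<Sum>h\<in>I. f h $$ (i, j))"

lemma mat_sum_carrier [simp]: "mat_sum n m f I \<in> carrier_mat n m"
  by (simp add: mat_sum_def)

lemma mat_sum_index: "i < n \<Longrightarrow> j < m \<Longrightarrow> mat_sum n m f I $$ (i, j) = (\<Sum>h\<in>I. f h $$ (i, j))"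
  by (simp add: mat_sum_def)

lemma mult_mat_sum:
  assumes A: "A \<in> carrier_mat p n" and f: "\<And>h. h \<in> I \<Longrightarrow> f h \<in> carrier_mat n m"
  shows "A * mat_sum n m f I = mat_sum p m (\<lambda>h. A * f h) I"
proof (rule eq_matI)
  fix i j assume "i < dim_row (mat_sum p m (\<lambda>h. A * f h) I)" "j < dim_col (mat_sum p m (\<lambda>h. A * f h) I)"
  then have ij: "i < p" "j < m" by (simp_all add: mat_sum_def)
  have "(A * mat_sum n m f I) $$ (i, j) = (\<Sum>k<n. A $$ (i, k) * (\<Sum>h\<in>I. f h $$ (k, j)))"
    by (subst index_mult_mat_sum[OF A mat_sum_carrier ij]) (simp add: mat_sum_index ij)
  also have "\<dots> = (\<Sum>h\<in>I. \<Sum>k<n. A $$ (i, k) * f h $$ (k, j))"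
    by (simp add: sum_distrib_left sum.swap[of _ _ I])
  also have "\<dots> = (\<Sum>h\<in>I. (A * f h) $$ (i, j))"
    by (intro sum.cong refl index_mult_mat_sum[OF A f ij, symmetric])
  finally show "(A * mat_sum n m f I) $$ (i, j) = mat_sum p m (\<lambda>h. A * f h) I $$ (i, j)"
    by (simp add: mat_sum_index ij)
qed (use A in \<open>auto simp: mat_sum_def\<close>)

lemma mat_sum_mult:
  assumes A: "A \<in> carrier_mat m p" and f: "\<And>h. h \<in> I \<Longrightarrow> f h \<in> carrier_mat n m"
  shows "mat_sum n m f I * A = mat_sum n p (\<lambda>h. f h * A) I"
proof (rule eq_matI)
  fix i j assume "i < dim_row (mat_sum n p (\<lambda>h. f h * A) I)" "j < dim_col (mat_sum n p (\<lambda>h. f h * A) I)"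
  then have ij: "i < n" "j < p" by (simp_all add: mat_sum_def)
  have "(mat_sum n m f I * A) $$ (i, j) = (\<Sum>k<m. (\<Sum>h\<in>I. f h $$ (i, k)) * A $$ (k, j))"
    by (subst index_mult_mat_sum[OF mat_sum_carrier A ij]) (simp add: mat_sum_index ij)
  also have "\<dots> = (\<Sum>h\<in>I. \<Sum>k<m. f h $$ (i, k) * A $$ (k, j))"
    by (simp add: sum_distrib_right sum.swap[of _ _ I])
  also have "\<dots> = (\<Sum>h\<in>I. (f h * A) $$ (i, j))"
    by (intro sum.cong refl index_mult_mat_sum[OF f A ij, symmetric])
  finally show "(mat_sum n m f I * A) $$ (i, j) = mat_sum n p (\<lambda>h. f h * A) I $$ (i, j)"
    by (simp add: mat_sum_index ij)
qed (use A in \<open>auto simp: mat_sum_def\<close>)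

lemma mat_sum_cong: "(\<And>h. h \<in> I \<Longrightarrow> f h = f' h) \<Longrightarrow> mat_sum n m f I = mat_sum n m f' I"
  by (simp add: mat_sum_def)

definition unit_mat :: "nat \<Rightarrow> nat \<Rightarrow> nat \<Rightarrow> nat \<Rightarrow> complex mat" where
  "unit_mat n m k l = mat n m (\<lambda>(i, j). if i = k \<and> j = l then 1 else 0)"

lemma unit_mat_carrier: "unit_mat n m k l \<in> carrier_mat n m"
  by (simp add: unit_mat_def)

section \<open>Representations of a finite group\<close>

locale fin_group = group G for G (structure) +
  assumes fin: "finite (carrier G)"
begin

lemma rep_carrier: "is_rep G V \<Longrightarrow> g \<in> carrier G \<Longrightarrow> snd V g \<in> carrier_mat (fst V) (fst V)"
  by (auto simp: is_rep_def hom_def GL_carrier)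

lemma rep_mult:
  "is_rep G V \<Longrightarrow> g \<in> carrier G \<Longrightarrow> h \<in> carrier G \<Longrightarrow> snd V (g \<otimes> h) = snd V g * snd V h"
  by (auto simp: is_rep_def hom_def GL_mult)

lemma rep_one: assumes V: "is_rep G V" shows "snd V \<one> = 1\<^sub>m (fst V)"
proof -
  let ?A = "snd V \<one>"
  have "?A \<in> carrier (GL TYPE(complex) (fst V))" using V by (auto simp: is_rep_def hom_def)
  then obtain H where A: "?A \<in> carrier_mat (fst V) (fst V)" and H: "H \<in> carrier_mat (fst V) (fst V)"
    and HA: "H * ?A = 1\<^sub>m (fst V)"
    by (auto simp: GL_carrier)
  have "?A = ?A * ?A" using rep_mult[OF V one_closed one_closed] by simp
  then have "H * ?A = H * (?A * ?A)" by simp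
  also have "\<dots> = (H * ?A) * ?A" using A H by simp
  finally show ?thesis using HA A by simp
qed

lemma rep_inv:
  assumes V: "is_rep G V" and g: "g \<in> carrier G"
  shows "snd V g * snd V (inv g) = 1\<^sub>m (fst V)" "snd V (inv g) * snd V g = 1\<^sub>m (fst V)"
  using rep_mult[OF V g inv_closed[OF g]] rep_mult[OF V inv_closed[OF g] g] rep_one[OF V] g
  by simp_all

lemma is_repI:
  assumes car: "\<And>g. g \<in> carrier G \<Longrightarrow> snd V g \<in> carrier_mat (fst V) (fst V)"
    and mult: "\<And>g h. g \<in> carrier G \<Longrightarrow> h \<in> carrier G \<Longrightarrow> snd V (g \<otimes> h) = snd V g * snd V h"
    and one: "snd V \<one> = 1\<^sub>m (fst V)"
  shows "is_rep G V"
proof -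
  have "snd V g \<in> carrier (GL TYPE(complex) (fst V))" if g: "g \<in> carrier G" for g
    unfolding GL_carrier
    using car[OF g] car[OF inv_closed[OF g]] mult[OF g inv_closed[OF g]] mult[OF inv_closed[OF g] g] one g
    by (auto intro!: bexI[of _ "snd V (inv g)"])
  then show ?thesis unfolding is_rep_def hom_def using mult by (auto simp: GL_mult)
qed

lemma is_rep_trivial: "is_rep G trivial_rep"
  by (rule is_repI) (simp_all add: trivial_rep_def)

lemma rep_isoI:
  assumes "is_rep G V" "is_rep G W" "fst V = fst W"
    and "P \<in> carrier_mat (fst V) (fst V)" "Q \<in> carrier_mat (fst V) (fst V)"
    and "Q * P = 1\<^sub>m (fst V)" "P * Q = 1\<^sub>m (fst V)"
    and "\<And>g. g \<in> carrier G \<Longrightarrow> P * snd V g = snd W g * P"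
  shows "rep_iso G V W"
proof -
  have "P \<in> carrier (GL TYPE(complex) (fst V))" unfolding GL_carrier using assms by blast
  then show ?thesis unfolding rep_iso_def using assms by blast
qed

lemma rep_isoE:
  assumes "rep_iso G V W"
  obtains P Q where "P \<in> carrier_mat (fst V) (fst V)" "Q \<in> carrier_mat (fst V) (fst V)"
    "Q * P = 1\<^sub>m (fst V)" "P * Q = 1\<^sub>m (fst V)"
    "\<And>g. g \<in> carrier G \<Longrightarrow> P * snd V g = snd W g * P"
proof -
  obtain P where P: "P \<in> carrier (GL TYPE(complex) (fst V))"
    and eq: "\<forall>g\<in>carrier G. P * snd V g = snd W g * P"
    using assms unfolding rep_iso_def by blast
  obtain Q where "P \<in> carrier_mat (fst V) (fst V)" "Q \<in> carrier_mat (fst V) (fst V)"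
    "Q * P = 1\<^sub>m (fst V)" "P * Q = 1\<^sub>m (fst V)"
    using P unfolding GL_carrier by blast
  then show thesis using eq that by blast
qed

lemma rep_iso_refl: assumes "is_rep G V" shows "rep_iso G V V"
proof (rule rep_isoI[of _ _ "1\<^sub>m (fst V)" "1\<^sub>m (fst V)"])
  show "1\<^sub>m (fst V) * snd V g = snd V g * 1\<^sub>m (fst V)" if "g \<in> carrier G" for g
    using rep_carrier[OF assms that] by simp
qed (use assms in auto)

lemma rep_iso_sym: assumes "rep_iso G V W" shows "rep_iso G W V"
proof -
  have d: "fst V = fst W" "is_rep G V" "is_rep G W" using assms by (auto simp: rep_iso_def)
  obtain P Q where P: "P \<in> carrier_mat (fst V) (fst V)" and Q: "Q \<in> carrier_mat (fst V) (fst V)"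
    and QP: "Q * P = 1\<^sub>m (fst V)" and PQ: "P * Q = 1\<^sub>m (fst V)"
    and eq: "\<And>g. g \<in> carrier G \<Longrightarrow> P * snd V g = snd W g * P"
    using assms by (rule rep_isoE) blast
  have "Q * snd W g = snd V g * Q" if g: "g \<in> carrier G" for g
  proof -
    have Vg: "snd V g \<in> carrier_mat (fst V) (fst V)" and Wg: "snd W g \<in> carrier_mat (fst V) (fst V)"
      using rep_carrier[OF d(2) g] rep_carrier[OF d(3) g] d(1) by auto
    have "Q * snd W g = Q * (snd W g * (P * Q))" using Q Wg PQ by simp
    also have "\<dots> = Q * ((snd W g * P) * Q)" using Q Wg P by simp
    also have "\<dots> = Q * ((P * snd V g) * Q)" using eq[OF g] by simp
    also have "\<dots> = (Q * P) * (snd V g * Q)" using Q P Vg by (simp add: assoc_mult_mat[of _ "fst V" "fst V" _ "fst V" _ "fst V"])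
    also have "\<dots> = snd V g * Q" using QP Vg Q by simp
    finally show ?thesis .
  qed
  with d P Q QP PQ show ?thesis by (intro rep_isoI[of _ _ Q P]) auto
qed

lemma rep_iso_trans: assumes "rep_iso G U V" "rep_iso G V W" shows "rep_iso G U W"
proof -
  have d: "fst U = fst V" "fst V = fst W" "is_rep G U" "is_rep G V" "is_rep G W"
    using assms by (auto simp: rep_iso_def)
  define n where "n = fst V"
  obtain P Q where P: "P \<in> carrier_mat n n" and Q: "Q \<in> carrier_mat n n"
    and QP: "Q * P = 1\<^sub>m n" and PQ: "P * Q = 1\<^sub>m n"
    and eq: "\<And>g. g \<in> carrier G \<Longrightarrow> P * snd U g = snd V g * P"
    using rep_isoE[OF assms(1)] d n_def by metis
  obtain P' Q' where P': "P' \<in> carrier_mat n n" and Q': "Q' \<in> carrier_mat n n"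
    and QP': "Q' * P' = 1\<^sub>m n" and PQ': "P' * Q' = 1\<^sub>m n"
    and eq': "\<And>g. g \<in> carrier G \<Longrightarrow> P' * snd V g = snd W g * P'"
    using rep_isoE[OF assms(2)] d n_def by metis
  note as = assoc_mult_mat[of _ n n _ n _ n]
  have e1: "(P' * P) * snd U g = snd W g * (P' * P)" if g: "g \<in> carrier G" for g
  proof -
    have Ug: "snd U g \<in> carrier_mat n n" and Vg: "snd V g \<in> carrier_mat n n" and Wg: "snd W g \<in> carrier_mat n n"
      using rep_carrier[OF d(3) g] rep_carrier[OF d(4) g] rep_carrier[OF d(5) g] d(1,2) n_def by auto
    have "(P' * P) * snd U g = P' * (P * snd U g)" using P P' Ug by (simp add: as)
    also have "\<dots> = (P' * snd V g) * P" using P P' Vg by (simp add: as eq[OF g])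
    also have "\<dots> = snd W g * (P' * P)" using P P' Wg by (simp add: as eq'[OF g])
    finally show ?thesis .
  qed
  have e2: "(Q * Q') * (P' * P) = 1\<^sub>m n"
  proof -
    have "(Q * Q') * (P' * P) = Q * ((Q' * P') * P)" using P P' Q Q' by (simp add: as)
    then show ?thesis using P QP QP' by simp
  qed
  have e3: "(P' * P) * (Q * Q') = 1\<^sub>m n"
  proof -
    have "(P' * P) * (Q * Q') = P' * ((P * Q) * Q')" using P P' Q Q' by (simp add: as)
    then show ?thesis using Q' PQ PQ' by simp
  qed
  show ?thesis
    by (rule rep_isoI[of _ _ "P' * P" "Q * Q'"]) (use d n_def P P' Q Q' e1 e2 e3 in auto)
qed

lemma irr_is_rep: "irreducible_rep G V \<Longrightarrow> is_rep G V"
  by (simp add: irreducible_rep_def)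

lemma irreducible_subspace:
  assumes "irreducible_rep G V" "linear_subset (fst V) W"
    and "\<And>g w. g \<in> carrier G \<Longrightarrow> w \<in> W \<Longrightarrow> snd V g *\<^sub>v w \<in> W"
  shows "W = {0\<^sub>v (fst V)} \<or> W = carrier_vec (fst V)"
  using assms unfolding irreducible_rep_def subspace_module_vec_iff by blast

lemma equiv_irr_iso_rel: "equiv {V. irreducible_rep G V} (irr_iso_rel G)"
  unfolding irr_iso_rel_def
  by (intro equivI refl_onI symI transI)
    (auto intro: rep_iso_refl rep_iso_sym rep_iso_trans simp: irr_is_rep)

lemma irreducible_trivial: "irreducible_rep G trivial_rep"
proof -
  have "W = {0\<^sub>v 1} \<or> W = carrier_vec 1" if W: "linear_subset 1 W" for W :: "complex vec set"
  proof (rule disjCI)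
    assume ne: "W \<noteq> carrier_vec 1"
    have "w = 0\<^sub>v 1" if w: "w \<in> W" for w
    proof (rule ccontr)
      assume w0: "w \<noteq> 0\<^sub>v 1"
      have wc: "w \<in> carrier_vec 1" using w W by (auto simp: linear_subset_def)
      then have "w $ 0 \<noteq> 0" using w0 by (auto simp: vec_eq_iff)
      then have "v = (v $ 0 / w $ 0) \<cdot>\<^sub>v w" if "v \<in> carrier_vec 1" for v
        using that wc by (intro eq_vecI) auto
      then have "carrier_vec 1 \<subseteq> W" using w W unfolding linear_subset_def by (metis subsetI)
      then show False using ne W by (auto simp: linear_subset_def)
    qed
    then show "W = {0\<^sub>v 1}" using W by (auto simp: linear_subset_def)
  qed
  then show ?thesis
    unfolding irreducible_rep_def subspace_module_vec_iff using is_rep_trivial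
    by (simp add: trivial_rep_def)
qed

section \<open>Schur's lemma\<close>

definition intertwiner :: "'a rep \<Rightarrow> 'a rep \<Rightarrow> complex mat \<Rightarrow> bool" where
  "intertwiner V W T \<longleftrightarrow> T \<in> carrier_mat (fst W) (fst V) \<and> (\<forall>g \<in> carrier G. T * snd V g = snd W g * T)"

text \<open>Kernel and image of an intertwiner are invariant subspaces, so a nonzero one has trivial kernel and
full image. Preimages of the unit vectors form the columns of an inverse, and the
two-sided inverse also forces the dimensions to agree.\<close>

lemma Schur_iso:
  assumes V: "irreducible_rep G V" and W: "irreducible_rep G W" and T: "intertwiner V W T"
    and T0: "T \<noteq> 0\<^sub>m (fst W) (fst V)"
  shows "rep_iso G V W"
proof -
  let ?n = "fst V" and ?m = "fst W"
  have Tc: "T \<in> carrier_mat ?m ?n" and eq: "\<And>g. g \<in> carrier G \<Longrightarrow> T * snd V g = snd W g * T"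
    using T by (auto simp: intertwiner_def)
  note rV = rep_carrier[OF irr_is_rep[OF V]] and rW = rep_carrier[OF irr_is_rep[OF W]]
  have act: "T *\<^sub>v (snd V g *\<^sub>v v) = snd W g *\<^sub>v (T *\<^sub>v v)" if "g \<in> carrier G" "v \<in> carrier_vec ?n" for g v
    using assoc_mult_mat_vec[OF Tc rV[OF that(1)] that(2)] assoc_mult_mat_vec[OF rW[OF that(1)] Tc that(2)]
      eq[OF that(1)] by simp
  have ex: "\<exists>v \<in> carrier_vec ?n. T *\<^sub>v v \<noteq> 0\<^sub>v ?m"
  proof (rule ccontr)
    assume "\<not> (\<exists>v \<in> carrier_vec ?n. T *\<^sub>v v \<noteq> 0\<^sub>v ?m)"
    then have z: "T *\<^sub>v v = 0\<^sub>v ?m" if "v \<in> carrier_vec ?n" for v using that by blast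
    have "T = 0\<^sub>m ?m ?n"
    proof (rule mat_col_eqI)
      fix j assume "j < dim_col (0\<^sub>m ?m ?n :: complex mat)"
      then have j: "j < ?n" by simp
      have "col T j = T *\<^sub>v unit_vec ?n j" by (rule col_eq_mult_unit_vec[OF Tc j])
      then show "col T j = col (0\<^sub>m ?m ?n) j" using z j by simp
    qed (use Tc in auto)
    with T0 show False by simp
  qed
  have W0: "snd W g *\<^sub>v 0\<^sub>v ?m = 0\<^sub>v ?m" if "g \<in> carrier G" for g
    using rW[OF that] by (intro eq_vecI) auto
  have "{v \<in> carrier_vec ?n. T *\<^sub>v v = 0\<^sub>v ?m} = {0\<^sub>v ?n} \<or>
      {v \<in> carrier_vec ?n. T *\<^sub>v v = 0\<^sub>v ?m} = carrier_vec ?n"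
  proof (rule irreducible_subspace[OF V linear_subset_kernel[OF Tc]])
    fix g w assume g: "g \<in> carrier G" and w: "w \<in> {v \<in> carrier_vec ?n. T *\<^sub>v v = 0\<^sub>v ?m}"
    then show "snd V g *\<^sub>v w \<in> {v \<in> carrier_vec ?n. T *\<^sub>v v = 0\<^sub>v ?m}"
      using act[OF g] W0[OF g] rV[OF g] by auto
  qed
  then have ker: "{v \<in> carrier_vec ?n. T *\<^sub>v v = 0\<^sub>v ?m} = {0\<^sub>v ?n}"
    using ex by blast
  have im: "(*\<^sub>v) T ` carrier_vec ?n = carrier_vec ?m"
  proof -
    have "(*\<^sub>v) T ` carrier_vec ?n \<noteq> {0\<^sub>v ?m}" using ex by auto
    moreover have "snd W g *\<^sub>v w \<in> (*\<^sub>v) T ` carrier_vec ?n"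
      if g: "g \<in> carrier G" and w: "w \<in> (*\<^sub>v) T ` carrier_vec ?n" for g w
    proof -
      from w obtain v where v: "v \<in> carrier_vec ?n" "w = T *\<^sub>v v" by auto
      show ?thesis unfolding v(2) act[OF g v(1), symmetric] using rV[OF g] v(1) by auto
    qed
    ultimately show ?thesis
      using irreducible_subspace[OF W linear_subset_image[OF Tc]] by blast
  qed
  have "\<forall>i. \<exists>v. v \<in> carrier_vec ?n \<and> (i < ?m \<longrightarrow> T *\<^sub>v v = unit_vec ?m i)"
  proof
    fix i
    have "unit_vec ?m i \<in> (*\<^sub>v) T ` carrier_vec ?n" unfolding im by simp
    then show "\<exists>v. v \<in> carrier_vec ?n \<and> (i < ?m \<longrightarrow> T *\<^sub>v v = unit_vec ?m i)" by auto
  qed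
  then obtain f where f: "\<And>i. f i \<in> carrier_vec ?n" "\<And>i. i < ?m \<Longrightarrow> T *\<^sub>v f i = unit_vec ?m i"
    by metis
  define S where "S = mat ?n ?m (\<lambda>(i, j). f j $ i)"
  have Sc: "S \<in> carrier_mat ?n ?m" by (simp add: S_def)
  have colS: "col S j = f j" if "j < ?m" for j using that f(1)[of j] by (intro eq_vecI) (auto simp: S_def)
  have TS: "T * S = 1\<^sub>m ?m"
  proof (rule mat_col_eqI)
    fix j assume "j < dim_col (1\<^sub>m ?m :: complex mat)"
    then have j: "j < ?m" by simp
    then show "col (T * S) j = col (1\<^sub>m ?m) j" using col_mult2[OF Tc Sc j] colS[OF j] f(2)[OF j] by simp
  qed (use Tc Sc in auto)
  have ST: "S * T = 1\<^sub>m ?n"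
  proof (rule mat_col_eqI)
    fix j assume "j < dim_col (1\<^sub>m ?n :: complex mat)"
    then have j: "j < ?n" by simp
    let ?e = "unit_vec ?n j :: complex vec"
    have e: "?e \<in> carrier_vec ?n" by simp
    have STc: "S *\<^sub>v (T *\<^sub>v ?e) \<in> carrier_vec ?n" using Sc Tc by simp
    have "T *\<^sub>v (S *\<^sub>v (T *\<^sub>v ?e)) = T *\<^sub>v ?e"
      by (rule mult_mat_vec_cancel[OF Sc Tc TS]) (use Tc in simp)
    then have "T *\<^sub>v (S *\<^sub>v (T *\<^sub>v ?e) - ?e) = 0\<^sub>v ?m"
      using mult_minus_distrib_mat_vec[OF Tc STc e] Tc by simp
    then have "S *\<^sub>v (T *\<^sub>v ?e) - ?e \<in> {0\<^sub>v ?n}" unfolding ker[symmetric] using STc by simp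
    then have "S *\<^sub>v (T *\<^sub>v ?e) - ?e + ?e = 0\<^sub>v ?n + ?e" by simp
    then have "S *\<^sub>v (T *\<^sub>v ?e) = ?e" using STc e by (simp add: minus_add_uminus_vec)
    then have "(S * T) *\<^sub>v ?e = ?e" using assoc_mult_mat_vec[OF Sc Tc e] by simp
    moreover have "col (S * T) j = (S * T) *\<^sub>v ?e"
      by (rule col_eq_mult_unit_vec) (use Sc Tc j in auto)
    ultimately show "col (S * T) j = col (1\<^sub>m ?n) j" using j by simp
  qed (use Tc Sc in auto)
  have mn: "?m = ?n" using card_le_of_right_inverse[OF Tc Sc TS] card_le_of_right_inverse[OF Sc Tc ST] by simp
  show ?thesis
    by (rule rep_isoI[of _ _ T S]) (use irr_is_rep[OF V] irr_is_rep[OF W] mn Tc Sc ST TS eq in auto)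
qed

text \<open>An eigenvalue exists over the complex numbers, and its eigenspace is a nonzero invariant subspace.\<close>

lemma Schur_scalar:
  assumes V: "irreducible_rep G V" and T: "intertwiner V V T"
  obtains c where "T = c \<cdot>\<^sub>m 1\<^sub>m (fst V)"
proof -
  let ?n = "fst V"
  have Tc: "T \<in> carrier_mat ?n ?n" and eq: "\<And>g. g \<in> carrier G \<Longrightarrow> T * snd V g = snd V g * T"
    using T by (auto simp: intertwiner_def)
  have "?n > 0" using V by (simp add: irreducible_rep_def)
  then obtain c where "eigenvalue T c" using spectrum_non_empty[OF Tc] by (auto simp: spectrum_def)
  then obtain v where v: "v \<in> carrier_vec ?n" "v \<noteq> 0\<^sub>v ?n" "T *\<^sub>v v = c \<cdot>\<^sub>v v"
    using Tc by (auto simp: eigenvalue_def eigenvector_def)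
  note rV = rep_carrier[OF irr_is_rep[OF V]]
  have E: "{v \<in> carrier_vec ?n. T *\<^sub>v v = c \<cdot>\<^sub>v v} = {0\<^sub>v ?n} \<or> {v \<in> carrier_vec ?n. T *\<^sub>v v = c \<cdot>\<^sub>v v} = carrier_vec ?n"
  proof (rule irreducible_subspace[OF V])
    show "linear_subset ?n {v \<in> carrier_vec ?n. T *\<^sub>v v = c \<cdot>\<^sub>v v}"
      using Tc by (auto simp: linear_subset_def mult_add_distrib_mat_vec mult_mat_vec smult_add_distrib_vec
        smult_smult_assoc mult.commute)
    show "snd V g *\<^sub>v w \<in> {v \<in> carrier_vec ?n. T *\<^sub>v v = c \<cdot>\<^sub>v v}"
      if g: "g \<in> carrier G" and w: "w \<in> {v \<in> carrier_vec ?n. T *\<^sub>v v = c \<cdot>\<^sub>v v}" for g w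
    proof -
      have wc: "w \<in> carrier_vec ?n" "T *\<^sub>v w = c \<cdot>\<^sub>v w" using w by auto
      have "T *\<^sub>v (snd V g *\<^sub>v w) = snd V g *\<^sub>v (T *\<^sub>v w)"
        using assoc_mult_mat_vec[OF Tc rV[OF g] wc(1)] assoc_mult_mat_vec[OF rV[OF g] Tc wc(1)] eq[OF g] by simp
      then show ?thesis using rV[OF g] wc by (simp add: mult_mat_vec)
    qed
  qed
  then have all: "T *\<^sub>v w = c \<cdot>\<^sub>v w" if "w \<in> carrier_vec ?n" for w using v that by blast
  have "T = c \<cdot>\<^sub>m 1\<^sub>m ?n"
  proof (rule mat_col_eqI)
    fix j assume "j < dim_col (c \<cdot>\<^sub>m 1\<^sub>m ?n :: complex mat)"
    then have j: "j < ?n" by simp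
    have "col T j = T *\<^sub>v unit_vec ?n j" by (rule col_eq_mult_unit_vec[OF Tc j])
    then show "col T j = col (c \<cdot>\<^sub>m 1\<^sub>m ?n) j" using all[of "unit_vec ?n j"] j by simp
  qed (use Tc in auto)
  then show thesis using that by blast
qed

section \<open>Characters and tensor products\<close>

lemma character_cong_iso: assumes "rep_iso G V W" "g \<in> carrier G" shows "character V g = character W g"
proof -
  have d: "fst V = fst W" "is_rep G V" "is_rep G W" using assms by (auto simp: rep_iso_def)
  obtain P Q where P: "P \<in> carrier_mat (fst V) (fst V)" and Q: "Q \<in> carrier_mat (fst V) (fst V)"
    and QP: "Q * P = 1\<^sub>m (fst V)"
    and eq: "\<And>g. g \<in> carrier G \<Longrightarrow> P * snd V g = snd W g * P"
    using assms(1) by (rule rep_isoE) blast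
  show ?thesis unfolding character_def d(1)[symmetric]
    by (rule trace_conj_invariant[OF P Q QP _ _ eq[OF assms(2)]])
      (use rep_carrier[OF d(2) assms(2)] rep_carrier[OF d(3) assms(2)] d(1) in auto)
qed

lemma character_one: "is_rep G V \<Longrightarrow> character V \<one> = of_nat (fst V)"
  by (simp add: character_def rep_one)

lemma character_conjugate:
  assumes V: "is_rep G V" and s: "s \<in> carrier G" and g: "g \<in> carrier G" and h: "h \<in> carrier G"
    and eq: "s \<otimes> h = g \<otimes> s"
  shows "character V h = character V g"
  unfolding character_def
proof (rule trace_conj_invariant)
  show "snd V s * snd V h = snd V g * snd V s"
    using eq rep_mult[OF V s h] rep_mult[OF V g s] by simp
qed (use rep_carrier[OF V] rep_inv[OF V s] s g h in auto)

lemma is_rep_tensor: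
  assumes V: "is_rep G V" and W: "is_rep G W"
  shows "is_rep G (tensor_rep V W)"
proof (rule is_repI)
  show "snd (tensor_rep V W) g \<in> carrier_mat (fst (tensor_rep V W)) (fst (tensor_rep V W))" if "g \<in> carrier G" for g
    using kronecker_product_carrier[OF rep_carrier[OF V that] rep_carrier[OF W that]] by (simp add: tensor_rep_def)
  show "snd (tensor_rep V W) (g \<otimes> h) = snd (tensor_rep V W) g * snd (tensor_rep V W) h"
    if g: "g \<in> carrier G" and h: "h \<in> carrier G" for g h
    using kronecker_product_mult[OF rep_carrier[OF V g] rep_carrier[OF W g] rep_carrier[OF V h] rep_carrier[OF W h]]
    by (simp add: tensor_rep_def rep_mult[OF V g h] rep_mult[OF W g h])
  show "snd (tensor_rep V W) \<one> = 1\<^sub>m (fst (tensor_rep V W))"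
    by (simp add: tensor_rep_def rep_one[OF V] rep_one[OF W] kronecker_product_one)
qed

lemma character_tensor:
  assumes V: "is_rep G V" and W: "is_rep G W" and g: "g \<in> carrier G"
  shows "character (tensor_rep V W) g = character V g * character W g"
proof -
  let ?n = "fst V" and ?m = "fst W"
  have "character (tensor_rep V W) g = (\<Sum>k<?n * ?m. snd V g $$ (k div ?m, k div ?m) * snd W g $$ (k mod ?m, k mod ?m))"
    using rep_carrier[OF V g] rep_carrier[OF W g]
    by (auto simp: character_def tensor_rep_def kronecker_product_def intro!: sum.cong)
  also have "\<dots> = (\<Sum>i<?n. \<Sum>j<?m. snd V g $$ (i, i) * snd W g $$ (j, j))"
    by (rule sum_lessThan_mult)
  finally show ?thesis by (simp add: character_def sum_product)
qed

section \<open>Direct sums\<close>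

lemma diag_block_rep_carrier:
  assumes "\<forall>U \<in> set Us. is_rep G U" and g: "g \<in> carrier G"
  shows "diag_block_mat (map (\<lambda>V. snd V g) Us) \<in> carrier_mat (sum_list (map fst Us)) (sum_list (map fst Us))"
proof -
  have "map dim_row (map (\<lambda>V. snd V g) Us) = map fst Us" "map dim_col (map (\<lambda>V. snd V g) Us) = map fst Us"
    using rep_carrier[OF bspec[OF assms(1)] g] by auto
  then show ?thesis by (intro carrier_matI) (simp_all only: dim_diag_block_mat)
qed

lemma direct_sum_Cons:
  assumes V: "is_rep G V" and Us: "\<forall>U \<in> set Us. is_rep G U" and g: "g \<in> carrier G"
  shows "snd (direct_sum_rep (V # Us)) g = four_block_mat (snd V g)
    (0\<^sub>m (fst V) (fst (direct_sum_rep Us))) (0\<^sub>m (fst (direct_sum_rep Us)) (fst V)) (snd (direct_sum_rep Us) g)"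
  using diag_block_rep_carrier[of Us, OF Us g] rep_carrier[OF V g]
  by (simp add: direct_sum_rep_def Let_def)

lemma direct_sum_append:
  assumes Us: "\<forall>U \<in> set Us. is_rep G U" and Ws: "\<forall>U \<in> set Ws. is_rep G U" and g: "g \<in> carrier G"
  shows "snd (direct_sum_rep (Us @ Ws)) g = four_block_mat (snd (direct_sum_rep Us) g)
    (0\<^sub>m (fst (direct_sum_rep Us)) (fst (direct_sum_rep Ws)))
    (0\<^sub>m (fst (direct_sum_rep Ws)) (fst (direct_sum_rep Us))) (snd (direct_sum_rep Ws) g)"
  using diag_block_rep_carrier[of Us, OF Us g] diag_block_rep_carrier[of Ws, OF Ws g]
  by (simp add: direct_sum_rep_def diag_block_mat_append Let_def)

lemma is_rep_direct_sum: "\<forall>U \<in> set Us. is_rep G U \<Longrightarrow> is_rep G (direct_sum_rep Us)"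
proof (induction Us)
  case Nil
  show ?case by (rule is_repI) (auto simp: direct_sum_rep_def)
next
  case (Cons V Us)
  have V: "is_rep G V" and Us: "\<forall>U \<in> set Us. is_rep G U" and D: "is_rep G (direct_sum_rep Us)"
    using Cons by auto
  have f: "fst (direct_sum_rep (V # Us)) = fst V + fst (direct_sum_rep Us)" by (simp add: direct_sum_rep_def)
  note dc = direct_sum_Cons[of V Us, OF V Us]
  show ?case
  proof (rule is_repI)
    show "snd (direct_sum_rep (V # Us)) g \<in> carrier_mat (fst (direct_sum_rep (V # Us))) (fst (direct_sum_rep (V # Us)))"
      if "g \<in> carrier G" for g
      unfolding dc[OF that] f using rep_carrier[OF V that] rep_carrier[OF D that] by simp
    show "snd (direct_sum_rep (V # Us)) (g \<otimes> h) = snd (direct_sum_rep (V # Us)) g * snd (direct_sum_rep (V # Us)) h"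
      if g: "g \<in> carrier G" and h: "h \<in> carrier G" for g h
      unfolding dc[OF g] dc[OF h] dc[OF m_closed[OF g h]]
      by (subst block_diag_mult) (use rep_carrier[OF V] rep_carrier[OF D] rep_mult[OF V] rep_mult[OF D] g h in auto)
    show "snd (direct_sum_rep (V # Us)) \<one> = 1\<^sub>m (fst (direct_sum_rep (V # Us)))"
      unfolding dc[OF one_closed] f by (simp add: rep_one[OF V] rep_one[OF D])
  qed
qed

lemma character_direct_sum:
  "\<forall>U \<in> set Us. is_rep G U \<Longrightarrow> g \<in> carrier G \<Longrightarrow>
    character (direct_sum_rep Us) g = (\<Sum>U\<leftarrow>Us. character U g)"
proof (induction Us)
  case Nil
  show ?case by (simp add: character_def direct_sum_rep_def)
next
  case (Cons V Us)
  have V: "is_rep G V" and Us: "\<forall>U \<in> set Us. is_rep G U" and D: "is_rep G (direct_sum_rep Us)"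
    using Cons.prems is_rep_direct_sum[of Us] by auto
  note g = \<open>g \<in> carrier G\<close>
  have f: "fst (direct_sum_rep (V # Us)) = fst V + fst (direct_sum_rep Us)" by (simp add: direct_sum_rep_def)
  have "character (direct_sum_rep (V # Us)) g = character V g + character (direct_sum_rep Us) g"
    unfolding character_def f direct_sum_Cons[of V Us, OF V Us g] sum_lessThan_add
    using rep_carrier[OF V g] rep_carrier[OF D g] by (auto intro!: arg_cong2[of _ _ _ _ "(+)"] sum.cong)
  then show ?case using Cons.IH[OF Us g] by simp
qed

lemma rep_iso_direct_sum_append:
  assumes 1: "rep_iso G V (direct_sum_rep Us)" and 2: "rep_iso G W (direct_sum_rep Ws)"
    and Us: "\<forall>U \<in> set Us. is_rep G U" and Ws: "\<forall>U \<in> set Ws. is_rep G U"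
  shows "rep_iso G (direct_sum_rep [V, W]) (direct_sum_rep (Us @ Ws))"
proof -
  have V: "is_rep G V" and W: "is_rep G W" and fV: "fst V = fst (direct_sum_rep Us)"
    and fW: "fst W = fst (direct_sum_rep Ws)"
    using 1 2 by (auto simp: rep_iso_def)
  define n m where "n = fst V" and "m = fst W"
  have f2: "fst (direct_sum_rep [V, W]) = n + m" by (simp add: direct_sum_rep_def n_def m_def)
  have f3: "fst (direct_sum_rep (Us @ Ws)) = n + m"
    unfolding n_def m_def fV fW by (simp add: direct_sum_rep_def)
  obtain P Q where P: "P \<in> carrier_mat n n" and Q: "Q \<in> carrier_mat n n"
    and QP: "Q * P = 1\<^sub>m n" and PQ: "P * Q = 1\<^sub>m n"
    and eq: "\<And>g. g \<in> carrier G \<Longrightarrow> P * snd V g = snd (direct_sum_rep Us) g * P"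
    using rep_isoE[OF 1] unfolding n_def by metis
  obtain P' Q' where P': "P' \<in> carrier_mat m m" and Q': "Q' \<in> carrier_mat m m"
    and QP': "Q' * P' = 1\<^sub>m m" and PQ': "P' * Q' = 1\<^sub>m m"
    and eq': "\<And>g. g \<in> carrier G \<Longrightarrow> P' * snd W g = snd (direct_sum_rep Ws) g * P'"
    using rep_isoE[OF 2] unfolding m_def by metis
  show ?thesis
  proof (rule rep_isoI[of _ _ "four_block_mat P (0\<^sub>m n m) (0\<^sub>m m n) P'" "four_block_mat Q (0\<^sub>m n m) (0\<^sub>m m n) Q'"], unfold f2)
    show "is_rep G (direct_sum_rep [V, W])" using V W by (intro is_rep_direct_sum) auto
    show "is_rep G (direct_sum_rep (Us @ Ws))" using Us Ws by (intro is_rep_direct_sum) auto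
    show "n + m = fst (direct_sum_rep (Us @ Ws))" using f3 by simp
    show "four_block_mat Q (0\<^sub>m n m) (0\<^sub>m m n) Q' * four_block_mat P (0\<^sub>m n m) (0\<^sub>m m n) P' = 1\<^sub>m (n + m)"
      using P Q P' Q' by (simp add: block_diag_mult QP QP')
    show "four_block_mat P (0\<^sub>m n m) (0\<^sub>m m n) P' * four_block_mat Q (0\<^sub>m n m) (0\<^sub>m m n) Q' = 1\<^sub>m (n + m)"
      using P Q P' Q' by (simp add: block_diag_mult PQ PQ')
    show "four_block_mat P (0\<^sub>m n m) (0\<^sub>m m n) P' * snd (direct_sum_rep [V, W]) g
      = snd (direct_sum_rep (Us @ Ws)) g * four_block_mat P (0\<^sub>m n m) (0\<^sub>m m n) P'" if g: "g \<in> carrier G" for g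
    proof -
      have e1: "snd (direct_sum_rep [V, W]) g = four_block_mat (snd V g) (0\<^sub>m n m) (0\<^sub>m m n) (snd W g)"
        using diag_block_mat_singleton[of "snd W g"] rep_carrier[OF V g] rep_carrier[OF W g]
        by (simp add: direct_sum_rep_def Let_def n_def m_def del: diag_block_mat_singleton)
      have e2: "snd (direct_sum_rep (Us @ Ws)) g = four_block_mat (snd (direct_sum_rep Us) g) (0\<^sub>m n m) (0\<^sub>m m n) (snd (direct_sum_rep Ws) g)"
        unfolding n_def m_def fV fW by (rule direct_sum_append[of Us Ws, OF Us Ws g])
      have c: "snd V g \<in> carrier_mat n n" "snd W g \<in> carrier_mat m m"
        "snd (direct_sum_rep Us) g \<in> carrier_mat n n" "snd (direct_sum_rep Ws) g \<in> carrier_mat m m"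
        using rep_carrier[OF V g] rep_carrier[OF W g] rep_carrier[OF is_rep_direct_sum[of Us, OF Us] g]
          rep_carrier[OF is_rep_direct_sum[of Ws, OF Ws] g] fV fW by (auto simp: n_def m_def)
      show ?thesis unfolding e1 e2 using c P P' by (simp add: block_diag_mult eq[OF g] eq'[OF g])
    qed
  qed (use P Q P' Q' in auto)
qed

section \<open>Orthogonality of irreducible characters\<close>

lemma bij_translate: "h \<in> carrier G \<Longrightarrow> bij_betw (\<lambda>g. h \<otimes> g) (carrier G) (carrier G)"
  by (rule bij_betw_byWitness[where f' = "\<lambda>g. inv h \<otimes> g"]) (auto simp: m_assoc[symmetric])

lemma bij_inv: "bij_betw (\<lambda>g. inv g) (carrier G) (carrier G)"
  by (rule bij_betw_byWitness[where f' = "\<lambda>g. inv g"]) auto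

lemma mat_sum_translate:
  "h \<in> carrier G \<Longrightarrow> mat_sum n m (\<lambda>g. f (h \<otimes> g)) (carrier G) = mat_sum n m f (carrier G)"
  unfolding mat_sum_def by (subst sum.reindex_bij_betw[OF bij_translate]) auto

lemma order_pos: "order G > 0"
  using fin order_gt_0_iff_finite by auto

text \<open>The average of a linear map over the group, without the factor \<open>1 / |G|\<close>. It is the source of all
intertwiners to which Schur's lemma is applied.\<close>

definition averaged :: "'a rep \<Rightarrow> 'a rep \<Rightarrow> complex mat \<Rightarrow> complex mat" where
  "averaged V W X = mat_sum (fst W) (fst V) (\<lambda>g. snd W g * (X * snd V (inv g))) (carrier G)"

text \<open>Multiplication by \<open>W(h)\<close> on the left or by \<open>V(h)\<close> on the right only translates the variable of
summation.\<close>

lemma intertwiner_averaged: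
  assumes V: "is_rep G V" and W: "is_rep G W" and X: "X \<in> carrier_mat (fst W) (fst V)"
  shows "intertwiner V W (averaged V W X)"
  unfolding intertwiner_def
proof (intro conjI ballI)
  show "averaged V W X \<in> carrier_mat (fst W) (fst V)" by (simp add: averaged_def)
  fix h assume h: "h \<in> carrier G"
  let ?F = "\<lambda>g. snd W g * (X * snd V (inv g))"
  note cV = rep_carrier[OF V] and cW = rep_carrier[OF W]
  have F: "?F g \<in> carrier_mat (fst W) (fst V)" if "g \<in> carrier G" for g
    using cV[OF inv_closed[OF that]] cW[OF that] X by simp
  have "averaged V W X * snd V h = mat_sum (fst W) (fst V) (\<lambda>g. ?F g * snd V h) (carrier G)"
    unfolding averaged_def by (rule mat_sum_mult[OF cV[OF h] F])
  also have "\<dots> = mat_sum (fst W) (fst V) (\<lambda>g. ?F (h \<otimes> g) * snd V h) (carrier G)"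
    by (rule mat_sum_translate[OF h, symmetric])
  also have "\<dots> = mat_sum (fst W) (fst V) (\<lambda>g. snd W h * ?F g) (carrier G)"
  proof (rule mat_sum_cong)
    fix g assume g: "g \<in> carrier G"
    have e: "snd V (inv (h \<otimes> g)) * snd V h = snd V (inv g)"
      using rep_mult[OF V, of "inv (h \<otimes> g)" h] g h by (simp add: inv_mult_group m_assoc)
    have "?F (h \<otimes> g) * snd V h = snd W (h \<otimes> g) * (X * (snd V (inv (h \<otimes> g)) * snd V h))"
      using cW[of "h \<otimes> g"] cV[of "inv (h \<otimes> g)"] cV[OF h] X g h
      by (simp add: assoc_mult_mat[of _ "fst W" "fst V" _ "fst V" _ "fst V"]
        assoc_mult_mat[of _ "fst W" "fst W" _ "fst V" _ "fst V"])
    also have "\<dots> = snd W h * ?F g"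
      unfolding e rep_mult[OF W h g] using cW[OF h] cW[OF g] cV[of "inv g"] X g
      by (simp add: assoc_mult_mat[of _ "fst W" "fst W" _ "fst W" _ "fst V"])
    finally show "?F (h \<otimes> g) * snd V h = snd W h * ?F g" .
  qed
  also have "\<dots> = snd W h * averaged V W X"
    unfolding averaged_def by (rule mult_mat_sum[OF cW[OF h] F, symmetric])
  finally show "averaged V W X * snd V h = snd W h * averaged V W X" .
qed

text \<open>Averaging matrix units produces the products of matrix coefficients from which products of
characters are assembled.\<close>

lemma averaged_unit_mat_index:
  assumes V: "is_rep G V" and W: "is_rep G W" and k: "k < fst W" and l: "l < fst V"
    and i: "i < fst W" and j: "j < fst V"
  shows "averaged V W (unit_mat (fst W) (fst V) k l) $$ (i, j)
    = (\<Sum>g\<in>carrier G. snd W g $$ (i, k) * snd V (inv g) $$ (l, j))"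
  unfolding averaged_def mat_sum_index[OF i j]
proof (rule sum.cong[OF refl])
  fix g assume g: "g \<in> carrier G"
  let ?X = "unit_mat (fst W) (fst V) k l"
  have X: "?X \<in> carrier_mat (fst W) (fst V)" by (simp add: unit_mat_def)
  note cV = rep_carrier[OF V inv_closed[OF g]] and cW = rep_carrier[OF W g]
  have XV: "(?X * snd V (inv g)) $$ (a, j) = (if a = k then snd V (inv g) $$ (l, j) else 0)"
    if a: "a < fst W" for a
  proof -
    have "(?X * snd V (inv g)) $$ (a, j) = (\<Sum>b<fst V. ?X $$ (a, b) * snd V (inv g) $$ (b, j))"
      by (rule index_mult_mat_sum[OF X cV a j])
    also have "\<dots> = (\<Sum>b<fst V. if b = l then (if a = k then snd V (inv g) $$ (l, j) else 0) else 0)"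
      using a by (intro sum.cong) (auto simp: unit_mat_def)
    also have "\<dots> = (if a = k then snd V (inv g) $$ (l, j) else 0)" using l by simp
    finally show ?thesis .
  qed
  have "(snd W g * (?X * snd V (inv g))) $$ (i, j)
      = (\<Sum>a<fst W. snd W g $$ (i, a) * (?X * snd V (inv g)) $$ (a, j))"
    by (rule index_mult_mat_sum[OF cW _ i j]) (use X cV in simp)
  also have "\<dots> = (\<Sum>a<fst W. if a = k then snd W g $$ (i, k) * snd V (inv g) $$ (l, j) else 0)"
    by (intro sum.cong) (auto simp: XV)
  also have "\<dots> = snd W g $$ (i, k) * snd V (inv g) $$ (l, j)" using k by simp
  finally show "(snd W g * (?X * snd V (inv g))) $$ (i, j) = snd W g $$ (i, k) * snd V (inv g) $$ (l, j)" .
qed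

text \<open>This bilinear form agrees on characters with the Hermitian inner product, since for them
\<open>\<psi>(g\<^sup>-\<^sup>1)\<close> is the complex conjugate of \<open>\<psi>(g)\<close>. Multiplicities only call for the bilinear form.\<close>

definition char_pairing :: "('a \<Rightarrow> complex) \<Rightarrow> ('a \<Rightarrow> complex) \<Rightarrow> complex" where
  "char_pairing \<phi> \<psi> = (\<Sum>g\<in>carrier G. \<phi> g * \<psi> (inv g)) / of_nat (order G)"

lemma char_pairing_cong:
  "(\<And>g. g \<in> carrier G \<Longrightarrow> \<phi> g = \<phi>' g) \<Longrightarrow> (\<And>g. g \<in> carrier G \<Longrightarrow> \<psi> g = \<psi>' g) \<Longrightarrow>
    char_pairing \<phi> \<psi> = char_pairing \<phi>' \<psi>'"
  by (simp add: char_pairing_def)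

lemma char_pairing_characters:
  assumes V: "is_rep G V" and W: "is_rep G W"
  shows "char_pairing (character W) (character V)
    = (\<Sum>i<fst W. \<Sum>j<fst V. averaged V W (unit_mat (fst W) (fst V) i j) $$ (i, j)) / of_nat (order G)"
proof -
  have "(\<Sum>g\<in>carrier G. character W g * character V (inv g))
      = (\<Sum>g\<in>carrier G. \<Sum>i<fst W. \<Sum>j<fst V. snd W g $$ (i, i) * snd V (inv g) $$ (j, j))"
    by (simp add: character_def sum_product)
  also have "\<dots> = (\<Sum>i<fst W. \<Sum>j<fst V. \<Sum>g\<in>carrier G. snd W g $$ (i, i) * snd V (inv g) $$ (j, j))"
    by (simp add: sum.swap[of _ _ "carrier G"])
  also have "\<dots> = (\<Sum>i<fst W. \<Sum>j<fst V. averaged V W (unit_mat (fst W) (fst V) i j) $$ (i, j))"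
    by (intro sum.cong refl averaged_unit_mat_index[OF V W, symmetric]) auto
  finally show ?thesis by (simp add: char_pairing_def)
qed

lemma character_orthogonal:
  assumes V: "irreducible_rep G V" and W: "irreducible_rep G W" and ne: "\<not> rep_iso G V W"
  shows "char_pairing (character W) (character V) = 0"
proof -
  have "averaged V W (unit_mat (fst W) (fst V) i j) = 0\<^sub>m (fst W) (fst V)" for i j
    using Schur_iso[OF V W intertwiner_averaged[OF irr_is_rep[OF V] irr_is_rep[OF W] unit_mat_carrier]] ne
    by blast
  then show ?thesis by (simp add: char_pairing_characters irr_is_rep[OF V] irr_is_rep[OF W])
qed

text \<open>By Schur's lemma the average of the matrix unit \<open>E\<^sub>i\<^sub>j\<close> is a scalar matrix. Its trace is \<open>|G|\<close> times the trace
of \<open>E\<^sub>i\<^sub>j\<close>, so the scalar is \<open>|G| / d\<close> for \<open>i = j\<close> and \<open>0\<close> otherwise.\<close>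

lemma character_norm:
  assumes V: "irreducible_rep G V"
  shows "char_pairing (character V) (character V) = 1"
proof -
  let ?n = "fst V"
  note rV = irr_is_rep[OF V]
  have n: "?n > 0" using V by (simp add: irreducible_rep_def)
  have entry: "averaged V V (unit_mat ?n ?n i j) $$ (i, j) = (if i = j then of_nat (order G) / of_nat ?n else 0)"
    if i: "i < ?n" and j: "j < ?n" for i j
  proof -
    let ?T = "averaged V V (unit_mat ?n ?n i j)"
    obtain c where c: "?T = c \<cdot>\<^sub>m 1\<^sub>m ?n"
      by (rule Schur_scalar[OF V intertwiner_averaged[OF rV rV unit_mat_carrier]])
    \<comment> \<open>The scalar is found by computing the trace of the average in two ways.\<close>
    have "of_nat ?n * c = (\<Sum>a<?n. ?T $$ (a, a))" by (simp add: c)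
    also have "\<dots> = (\<Sum>a<?n. \<Sum>g\<in>carrier G. snd V g $$ (a, i) * snd V (inv g) $$ (j, a))"
      by (intro sum.cong refl averaged_unit_mat_index[OF rV rV i j]) auto
    also have "\<dots> = (\<Sum>g\<in>carrier G. \<Sum>a<?n. snd V (inv g) $$ (j, a) * snd V g $$ (a, i))"
      by (subst sum.swap) (simp add: mult.commute)
    also have "\<dots> = (\<Sum>g\<in>carrier G. (snd V (inv g) * snd V g) $$ (j, i))"
      by (intro sum.cong refl index_mult_mat_sum[OF _ _ j i, symmetric] rep_carrier[OF rV]) auto
    also have "\<dots> = (\<Sum>g\<in>carrier G. (if i = j then 1 else 0))"
      using i j by (intro sum.cong refl) (auto simp: rep_inv[OF rV])
    also have "\<dots> = (if i = j then of_nat (order G) else 0)" by (simp add: order_def)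
    finally have "c = (if i = j then of_nat (order G) else 0) / of_nat ?n" using n by (simp add: field_simps)
    then show ?thesis using i j by (simp add: c)
  qed
  have "(\<Sum>i<?n. \<Sum>j<?n. averaged V V (unit_mat ?n ?n i j) $$ (i, j)) = (\<Sum>i<?n. of_nat (order G) / of_nat ?n)"
    by (intro sum.cong refl) (simp add: entry)
  also have "\<dots> = of_nat (order G)" using n by simp
  finally show ?thesis using order_pos by (simp add: char_pairing_characters[OF rV rV])
qed

section \<open>Complete reducibility\<close>

text \<open>In a basis adapted to \<open>W\<close> the representation is block upper triangular, with diagonal blocks \<open>A\<close>, \<open>D\<close> and
corner \<open>B\<close> satisfying \<open>B(gh) = A(g) B(h) + B(g) D(h)\<close>. This is a cocycle condition, and averaging makes
the cocycle a coboundary: \<open>X = (1 / |G|) \<Sum>\<^sub>h B(h) D(h\<^sup>-\<^sup>1)\<close> satisfies \<open>A(g) X + B(g) = X D(g)\<close>. Conjugation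
by the unipotent matrix with corner \<open>X\<close> therefore removes the corner \<open>B\<close>.\<close>

lemma split_invariant_subspace:
  assumes V: "is_rep G V" and W: "linear_subset (fst V) W"
    and inv: "\<And>g w. g \<in> carrier G \<Longrightarrow> w \<in> W \<Longrightarrow> snd V g *\<^sub>v w \<in> W"
    and W0: "W \<noteq> {0\<^sub>v (fst V)}" and W1: "W \<noteq> carrier_vec (fst V)"
  obtains V1 V2 where "is_rep G V1" "is_rep G V2" "fst V1 < fst V" "fst V2 < fst V"
    "rep_iso G V (direct_sum_rep [V1, V2])"
proof -
  define n where "n = fst V"
  obtain S T k where S: "S \<in> carrier_mat n n" and T: "T \<in> carrier_mat n n" and ST: "S * T = 1\<^sub>m n"
    and TS: "T * S = 1\<^sub>m n" and kn: "k \<le> n"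
    and Weq: "W = {v \<in> carrier_vec n. \<forall>i. k \<le> i \<and> i < n \<longrightarrow> (T *\<^sub>v v) $ i = 0}"
    by (rule adapted_basis[OF W[folded n_def]])
  note as = assoc_mult_mat[of _ n n _ n _ n]
  have cV: "snd V g \<in> carrier_mat n n" if "g \<in> carrier G" for g
    using rep_carrier[OF V that] by (simp add: n_def)
  have "k \<noteq> n" using W1 unfolding Weq n_def by auto
  then have k1: "k < n" using kn by simp
  have "k \<noteq> 0"
  proof
    assume "k = 0"
    have "v = 0\<^sub>v n" if "v \<in> W" for v
    proof -
      have vc: "v \<in> carrier_vec n" and z: "T *\<^sub>v v = 0\<^sub>v n"
        using that T \<open>k = 0\<close> unfolding Weq by (auto intro!: eq_vecI)
      have "v = S *\<^sub>v (T *\<^sub>v v)" by (rule mult_mat_vec_cancel[OF T S ST vc, symmetric])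
      also have "\<dots> = 0\<^sub>v n" unfolding z using S by (intro eq_vecI) auto
      finally show ?thesis .
    qed
    then have "W = {0\<^sub>v n}" using W by (auto simp: linear_subset_def n_def)
    then show False using W0 by (simp add: n_def)
  qed
  define m where "m = n - k"
  have nkm: "n = k + m" and m: "m < n" using k1 \<open>k \<noteq> 0\<close> by (auto simp: m_def)
  define M where "M g = T * (snd V g * S)" for g
  have Mc: "M g \<in> carrier_mat n n" if "g \<in> carrier G" for g using cV[OF that] S T by (simp add: M_def)
  have M_mult: "M (g \<otimes> h) = M g * M h" if g: "g \<in> carrier G" and h: "h \<in> carrier G" for g h
  proof -
    have "M g * M h = T * (snd V g * ((S * T) * (snd V h * S)))"
      using S T cV[OF g] cV[OF h] by (simp add: M_def as)
    also have "\<dots> = T * (snd V g * (snd V h * S))" using S cV[OF h] by (simp add: ST)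
    also have "\<dots> = M (g \<otimes> h)" using S T cV[OF g] cV[OF h] by (simp add: M_def rep_mult[OF V g h] as)
    finally show ?thesis ..
  qed
  have M_one: "M \<one> = 1\<^sub>m n" using S TS by (simp add: M_def rep_one[OF V] flip: n_def)
  have M_zero: "M g $$ (i, j) = 0" if g: "g \<in> carrier G" and j: "j < k" and i: "k \<le> i" "i < n" for g i j
  proof -
    let ?e = "unit_vec n j :: complex vec"
    have e: "?e \<in> carrier_vec n" by simp
    have "T *\<^sub>v (S *\<^sub>v ?e) = ?e" by (rule mult_mat_vec_cancel[OF S T TS e])
    then have "S *\<^sub>v ?e \<in> W" unfolding Weq using S j k1 by auto
    then have "snd V g *\<^sub>v (S *\<^sub>v ?e) \<in> W" by (rule inv[OF g])
    then have "(T *\<^sub>v (snd V g *\<^sub>v (S *\<^sub>v ?e))) $ i = 0" unfolding Weq using i by blast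
    moreover have "T *\<^sub>v (snd V g *\<^sub>v (S *\<^sub>v ?e)) = M g *\<^sub>v ?e"
      unfolding M_def using assoc_mult_mat_vec[OF T mult_carrier_mat[OF cV[OF g] S] e]
        assoc_mult_mat_vec[OF cV[OF g] S e] by simp
    moreover have "M g *\<^sub>v ?e = col (M g) j" using col_eq_mult_unit_vec[OF Mc[OF g]] j k1 by simp
    ultimately show ?thesis using Mc[OF g] i j k1 by auto
  qed
  define A where "A g = mat k k (\<lambda>(i, j). M g $$ (i, j))" for g
  define B where "B g = mat k m (\<lambda>(i, j). M g $$ (i, k + j))" for g
  define D where "D g = mat m m (\<lambda>(i, j). M g $$ (k + i, k + j))" for g
  have Ac: "A g \<in> carrier_mat k k" and Bc: "B g \<in> carrier_mat k m" and Dc: "D g \<in> carrier_mat m m" for g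
    by (simp_all add: A_def B_def D_def)
  have blocks: "M g = four_block_mat (A g) (B g) (0\<^sub>m m k) (D g)" if g: "g \<in> carrier G" for g
  proof (rule eq_matI)
    fix i j assume "i < dim_row (four_block_mat (A g) (B g) (0\<^sub>m m k) (D g))"
      "j < dim_col (four_block_mat (A g) (B g) (0\<^sub>m m k) (D g))"
    then have "i < k + m" "j < k + m" by (auto simp: A_def D_def)
    then show "M g $$ (i, j) = four_block_mat (A g) (B g) (0\<^sub>m m k) (D g) $$ (i, j)"
      using M_zero[OF g] by (auto simp: A_def B_def D_def nkm)
  qed (use Mc[OF g] in \<open>auto simp: A_def D_def nkm\<close>)
  have prod: "A (g \<otimes> h) = A g * A h" "B (g \<otimes> h) = A g * B h + B g * D h" "D (g \<otimes> h) = D g * D h"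
    if g: "g \<in> carrier G" and h: "h \<in> carrier G" for g h
  proof -
    have "four_block_mat (A (g \<otimes> h)) (B (g \<otimes> h)) (0\<^sub>m m k) (D (g \<otimes> h))
        = four_block_mat (A g) (B g) (0\<^sub>m m k) (D g) * four_block_mat (A h) (B h) (0\<^sub>m m k) (D h)"
      using M_mult[OF g h] blocks g h by simp
    also have "\<dots> = four_block_mat (A g * A h + B g * 0\<^sub>m m k) (A g * B h + B g * D h)
        (0\<^sub>m m k * A h + D g * 0\<^sub>m m k) (0\<^sub>m m k * B h + D g * D h)"
      by (rule mult_four_block_mat[OF Ac Bc _ Dc Ac Bc _ Dc]) auto
    also have "\<dots> = four_block_mat (A g * A h) (A g * B h + B g * D h) (0\<^sub>m m k) (D g * D h)"
      using Ac[of g] Ac[of h] Bc[of g] Bc[of h] Dc[of g] Dc[of h] by simp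
    finally have eq: "four_block_mat (A (g \<otimes> h)) (B (g \<otimes> h)) (0\<^sub>m m k) (D (g \<otimes> h)) = \<dots>" .
    show "A (g \<otimes> h) = A g * A h" "B (g \<otimes> h) = A g * B h + B g * D h" "D (g \<otimes> h) = D g * D h"
      using four_block_mat_eqD[OF eq Ac Bc zero_carrier_mat Dc mult_carrier_mat[OF Ac Ac]
        add_carrier_mat[OF mult_carrier_mat[OF Bc Dc]] zero_carrier_mat mult_carrier_mat[OF Dc Dc]] by auto
  qed
  have one: "A \<one> = 1\<^sub>m k" "D \<one> = 1\<^sub>m m"
  proof -
    have "four_block_mat (A \<one>) (B \<one>) (0\<^sub>m m k) (D \<one>) = four_block_mat (1\<^sub>m k) (0\<^sub>m k m) (0\<^sub>m m k) (1\<^sub>m m)"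
      using blocks[OF one_closed] M_one by (simp add: nkm)
    from four_block_mat_eqD[OF this Ac Bc zero_carrier_mat Dc one_carrier_mat zero_carrier_mat zero_carrier_mat one_carrier_mat]
    show "A \<one> = 1\<^sub>m k" "D \<one> = 1\<^sub>m m" by auto
  qed
  define V1 V2 where "V1 = (k, A)" and "V2 = (m, D)"
  have r1: "is_rep G V1" and r2: "is_rep G V2"
    unfolding V1_def V2_def by (rule is_repI; simp add: Ac Dc prod one)+
  \<comment> \<open>Translating the summation variable by \<open>g\<close> turns the cocycle condition for \<open>B\<close> into the coboundary equation \<open>XD\<close>.\<close>
  define E where "E h = B h * D (inv h)" for h
  have Ec: "E h \<in> carrier_mat k m" for h unfolding E_def by (rule mult_carrier_mat[OF Bc Dc])
  define X where "X = (1 / of_nat (order G)) \<cdot>\<^sub>m mat_sum k m E (carrier G)"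
  have Xc: "X \<in> carrier_mat k m" by (simp add: X_def)
  have XD: "A g * X + B g = X * D g" if g: "g \<in> carrier G" for g
  proof -
    have key: "A g * E h + B g = E (g \<otimes> h) * D g" if h: "h \<in> carrier G" for h
    proof -
      have D1: "D h * D (inv h) = 1\<^sub>m m" using prod(3)[OF h inv_closed[OF h]] one h by simp
      have D2: "D (inv (g \<otimes> h)) * D g = D (inv h)"
        using prod(3)[of "inv (g \<otimes> h)" g] g h by (simp add: inv_mult_group m_assoc)
      have "E (g \<otimes> h) * D g = B (g \<otimes> h) * (D (inv (g \<otimes> h)) * D g)"
        unfolding E_def by (rule assoc_mult_mat[OF Bc Dc Dc])
      also have "\<dots> = (A g * B h + B g * D h) * D (inv h)" by (simp add: D2 prod(2)[OF g h])
      also have "\<dots> = A g * B h * D (inv h) + B g * D h * D (inv h)"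
        by (rule add_mult_distrib_mat[OF mult_carrier_mat[OF Ac Bc] mult_carrier_mat[OF Bc Dc] Dc])
      also have "A g * B h * D (inv h) = A g * E h"
        unfolding E_def by (rule assoc_mult_mat[OF Ac Bc Dc])
      also have "B g * D h * D (inv h) = B g * (D h * D (inv h))" by (rule assoc_mult_mat[OF Bc Dc Dc])
      also have "\<dots> = B g" using Bc[of g] by (simp add: D1)
      finally show ?thesis ..
    qed
    have "A g * X + B g = (1 / of_nat (order G)) \<cdot>\<^sub>m mat_sum k m (\<lambda>h. A g * E h + B g) (carrier G)"
    proof -
      have "A g * X = (1 / of_nat (order G)) \<cdot>\<^sub>m (A g * mat_sum k m E (carrier G))"
        unfolding X_def by (rule mult_smult_distrib[OF Ac mat_sum_carrier])
      also have "A g * mat_sum k m E (carrier G) = mat_sum k m (\<lambda>h. A g * E h) (carrier G)"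
        by (rule mult_mat_sum[OF Ac Ec])
      finally have e: "A g * X = (1 / of_nat (order G)) \<cdot>\<^sub>m mat_sum k m (\<lambda>h. A g * E h) (carrier G)" .
      show ?thesis unfolding e
      proof (rule eq_matI)
        fix i j assume "i < dim_row ((1 / of_nat (order G)) \<cdot>\<^sub>m mat_sum k m (\<lambda>h. A g * E h + B g) (carrier G))"
          "j < dim_col ((1 / of_nat (order G)) \<cdot>\<^sub>m mat_sum k m (\<lambda>h. A g * E h + B g) (carrier G))"
        then have ij: "i < k" "j < m" by (auto simp: mat_sum_def)
        have d: "dim_row (A g) = k" "dim_row (E h) = k" "dim_row (B g) = k"
          "dim_col (E h) = m" "dim_col (B g) = m" for h using Ac[of g] Ec[of h] Bc[of g] by auto
        have "(\<Sum>h\<in>carrier G. (A g * E h + B g) $$ (i, j))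
          = (\<Sum>h\<in>carrier G. (A g * E h) $$ (i, j) + B g $$ (i, j))"
          using d ij by (intro sum.cong refl) (simp add: index_add_mat)
        also have "\<dots> = (\<Sum>h\<in>carrier G. (A g * E h) $$ (i, j)) + of_nat (order G) * B g $$ (i, j)"
          by (simp add: sum.distrib order_def)
        finally have "(\<Sum>h\<in>carrier G. (A g * E h + B g) $$ (i, j)) = \<dots>" .
        then show "((1 / of_nat (order G)) \<cdot>\<^sub>m mat_sum k m (\<lambda>h. A g * E h) (carrier G) + B g) $$ (i, j)
          = ((1 / of_nat (order G)) \<cdot>\<^sub>m mat_sum k m (\<lambda>h. A g * E h + B g) (carrier G)) $$ (i, j)"
          using ij order_pos d by (simp add: mat_sum_def field_simps flip: order_def)
      qed (use Bc[of g] in \<open>auto simp: mat_sum_def\<close>)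
    qed
    also have "mat_sum k m (\<lambda>h. A g * E h + B g) (carrier G) = mat_sum k m (\<lambda>h. E (g \<otimes> h) * D g) (carrier G)"
      by (rule mat_sum_cong) (rule key)
    also have "\<dots> = mat_sum k m (\<lambda>h. E h * D g) (carrier G)" by (rule mat_sum_translate[OF g])
    also have "\<dots> = mat_sum k m E (carrier G) * D g" by (rule mat_sum_mult[OF Dc Ec, symmetric])
    also have "(1 / of_nat (order G)) \<cdot>\<^sub>m (mat_sum k m E (carrier G) * D g) = X * D g"
      unfolding X_def by (rule mult_smult_assoc_mat[OF mat_sum_carrier Dc, symmetric])
    finally show ?thesis .
  qed
  define P P' where "P = four_block_mat (1\<^sub>m k) X (0\<^sub>m m k) (1\<^sub>m m)"
    and "P' = four_block_mat (1\<^sub>m k) (- X) (0\<^sub>m m k) (1\<^sub>m m)"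
  have Pc: "P \<in> carrier_mat n n" and P'c: "P' \<in> carrier_mat n n"
    using Xc by (auto simp: P_def P'_def nkm)
  have neg0: "- 0\<^sub>m m m = (0\<^sub>m m m :: complex mat)" by (intro eq_matI) auto
  have PP': "P * P' = 1\<^sub>m n"
    unfolding P_def P'_def nkm using Xc
    by (subst mult_four_block_mat[of _ k k _ m _ m _ _ k _ m]) (auto simp: comm_add_mat[of "- X" k m X] neg0)
  have P'P: "P' * P = 1\<^sub>m n" by (rule mat_mult_left_right_inverse[OF Pc P'c PP'])
  have MP: "M g * P = P * snd (direct_sum_rep [V1, V2]) g" if g: "g \<in> carrier G" for g
  proof -
    have e: "snd (direct_sum_rep [V1, V2]) g = four_block_mat (A g) (0\<^sub>m k m) (0\<^sub>m m k) (D g)"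
      using diag_block_mat_singleton[of "D g"] Ac[of g] Dc[of g]
      by (simp add: direct_sum_rep_def Let_def V1_def V2_def del: diag_block_mat_singleton)
    have "M g * P = four_block_mat (A g * 1\<^sub>m k + B g * 0\<^sub>m m k) (A g * X + B g * 1\<^sub>m m)
        (0\<^sub>m m k * 1\<^sub>m k + D g * 0\<^sub>m m k) (0\<^sub>m m k * X + D g * 1\<^sub>m m)"
      unfolding blocks[OF g] P_def by (rule mult_four_block_mat[OF Ac Bc _ Dc _ Xc]) auto
    also have "\<dots> = four_block_mat (A g) (X * D g) (0\<^sub>m m k) (D g)"
      using Ac[of g] Bc[of g] Dc[of g] Xc XD[OF g] by simp
    also have "\<dots> = four_block_mat (1\<^sub>m k * A g + X * 0\<^sub>m m k) (1\<^sub>m k * 0\<^sub>m k m + X * D g)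
        (0\<^sub>m m k * A g + 1\<^sub>m m * 0\<^sub>m m k) (0\<^sub>m m k * 0\<^sub>m k m + 1\<^sub>m m * D g)"
      using Ac[of g] Dc[of g] Xc mult_carrier_mat[OF Xc Dc[of g]] by simp
    also have "\<dots> = P * snd (direct_sum_rep [V1, V2]) g"
      unfolding P_def e by (rule mult_four_block_mat[symmetric, OF _ Xc _ _ Ac _ _ Dc]) auto
    finally show ?thesis .
  qed
  have "rep_iso G (direct_sum_rep [V1, V2]) V"
  proof (rule rep_isoI[of _ _ "S * P" "P' * T"])
    have f: "fst (direct_sum_rep [V1, V2]) = n" by (simp add: direct_sum_rep_def V1_def V2_def nkm)
    show "is_rep G (direct_sum_rep [V1, V2])" using r1 r2 by (intro is_rep_direct_sum) auto
    show "is_rep G V" by fact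
    show "fst (direct_sum_rep [V1, V2]) = fst V" by (simp add: f n_def)
    show "S * P \<in> carrier_mat (fst (direct_sum_rep [V1, V2])) (fst (direct_sum_rep [V1, V2]))"
      "P' * T \<in> carrier_mat (fst (direct_sum_rep [V1, V2])) (fst (direct_sum_rep [V1, V2]))"
      unfolding f using S T Pc P'c by auto
    have "(P' * T) * (S * P) = P' * ((T * S) * P)" using S T Pc P'c by (simp add: as)
    then show i: "(P' * T) * (S * P) = 1\<^sub>m (fst (direct_sum_rep [V1, V2]))"
      unfolding f using Pc P'P TS by simp
    have "(S * P) * (P' * T) = S * ((P * P') * T)" using S T Pc P'c by (simp add: as)
    then show "(S * P) * (P' * T) = 1\<^sub>m (fst (direct_sum_rep [V1, V2]))"
      unfolding f using T PP' ST by simp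
    show "(S * P) * snd (direct_sum_rep [V1, V2]) g = snd V g * (S * P)" if g: "g \<in> carrier G" for g
    proof -
      have c: "snd (direct_sum_rep [V1, V2]) g \<in> carrier_mat n n"
        using rep_carrier[OF \<open>is_rep G (direct_sum_rep [V1, V2])\<close> g] by (simp add: f)
      have "(S * P) * snd (direct_sum_rep [V1, V2]) g = S * (M g * P)" using S Pc c by (simp add: as MP[OF g])
      also have "\<dots> = (S * T) * (snd V g * (S * P))" using S T Pc cV[OF g] by (simp add: M_def as)
      also have "\<dots> = snd V g * (S * P)" using S Pc cV[OF g] by (simp add: ST)
      finally show ?thesis .
    qed
  qed
  then have "rep_iso G V (direct_sum_rep [V1, V2])" by (rule rep_iso_sym)
  then show thesis using that[OF r1 r2] k1 m by (simp add: V1_def V2_def n_def)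
qed

text \<open>Maschke's theorem, by splitting off invariant subspaces until the summands are irreducible. A
representation of degree \<open>0\<close> is the empty sum.\<close>

theorem complete_reducibility:
  "is_rep G V \<Longrightarrow> \<exists>Us. (\<forall>U \<in> set Us. irreducible_rep G U) \<and> rep_iso G V (direct_sum_rep Us)"
proof (induction "fst V" arbitrary: V rule: less_induct)
  case less
  note V = \<open>is_rep G V\<close>
  consider "fst V = 0" | "irreducible_rep G V" | "fst V > 0" "\<not> irreducible_rep G V" by blast
  then show ?case
  proof cases
    case 1
    have "rep_iso G V (direct_sum_rep [])"
    proof (rule rep_isoI[of _ _ "1\<^sub>m 0" "1\<^sub>m 0"])
      show "1\<^sub>m 0 * snd V g = snd (direct_sum_rep []) g * 1\<^sub>m 0" if "g \<in> carrier G" for g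
        using rep_carrier[OF V that] 1 by (intro eq_matI) (auto simp: direct_sum_rep_def)
      show "is_rep G (direct_sum_rep [])" by (rule is_rep_direct_sum) simp
    qed (use V 1 in \<open>auto simp: direct_sum_rep_def\<close>)
    then show ?thesis by (intro exI[of _ "[]"]) simp
  next
    case 2
    have "direct_sum_rep [V] = V"
      unfolding direct_sum_rep_def list.map diag_block_mat_singleton by simp
    then show ?thesis using 2 V by (intro exI[of _ "[V]"]) (simp add: rep_iso_refl)
  next
    case 3
    then obtain W where W: "linear_subset (fst V) W"
      and inv: "\<And>g w. g \<in> carrier G \<Longrightarrow> w \<in> W \<Longrightarrow> snd V g *\<^sub>v w \<in> W"
      and ne: "W \<noteq> {0\<^sub>v (fst V)}" "W \<noteq> carrier_vec (fst V)"
      using V unfolding irreducible_rep_def subspace_module_vec_iff by blast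
    obtain V1 V2 where r: "is_rep G V1" "is_rep G V2" and d: "fst V1 < fst V" "fst V2 < fst V"
      and iso: "rep_iso G V (direct_sum_rep [V1, V2])"
      using split_invariant_subspace[OF V W inv ne] by blast
    obtain Us where Us: "\<forall>U \<in> set Us. irreducible_rep G U" "rep_iso G V1 (direct_sum_rep Us)"
      using less.hyps[OF d(1) r(1)] by blast
    obtain Ws where Ws: "\<forall>U \<in> set Ws. irreducible_rep G U" "rep_iso G V2 (direct_sum_rep Ws)"
      using less.hyps[OF d(2) r(2)] by blast
    have "rep_iso G (direct_sum_rep [V1, V2]) (direct_sum_rep (Us @ Ws))"
      using Us Ws irr_is_rep by (intro rep_iso_direct_sum_append) auto
    then have "rep_iso G V (direct_sum_rep (Us @ Ws))" by (rule rep_iso_trans[OF iso])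
    then show ?thesis using Us Ws by (intro exI[of _ "Us @ Ws"]) auto
  qed
qed

section \<open>Isomorphism classes and multiplicities\<close>

lemma representative_mem: assumes "\<rho> \<in> Irr G" shows "representative \<rho> \<in> \<rho>"
proof -
  have "\<rho> \<noteq> {}" using assms in_quotient_imp_non_empty[OF equiv_irr_iso_rel] by (auto simp: Irr_def)
  then show ?thesis unfolding representative_def by (simp add: some_in_eq)
qed

lemma Irr_memD: "\<rho> \<in> Irr G \<Longrightarrow> U \<in> \<rho> \<Longrightarrow> irreducible_rep G U"
  using in_quotient_imp_subset[OF equiv_irr_iso_rel] by (auto simp: Irr_def)

lemma irreducible_representative: "\<rho> \<in> Irr G \<Longrightarrow> irreducible_rep G (representative \<rho>)"
  using Irr_memD representative_mem by blast

lemma Irr_mem_iff: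
  assumes \<rho>: "\<rho> \<in> Irr G" and U: "irreducible_rep G U"
  shows "U \<in> \<rho> \<longleftrightarrow> rep_iso G U (representative \<rho>)"
proof
  assume "U \<in> \<rho>"
  then have "(U, representative \<rho>) \<in> irr_iso_rel G"
    using in_quotient_imp_in_rel[OF equiv_irr_iso_rel, of \<rho> U "representative \<rho>"] \<rho> representative_mem[OF \<rho>]
    by (simp add: Irr_def)
  then show "rep_iso G U (representative \<rho>)" by (simp add: irr_iso_rel_def)
next
  assume "rep_iso G U (representative \<rho>)"
  then have "(representative \<rho>, U) \<in> irr_iso_rel G"
    using U irreducible_representative[OF \<rho>] rep_iso_sym by (auto simp: irr_iso_rel_def)
  then show "U \<in> \<rho>"
    using in_quotient_imp_closed[OF equiv_irr_iso_rel _ representative_mem[OF \<rho>], of U] \<rho>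
    by (simp add: Irr_def)
qed

lemma class_in_Irr: "irreducible_rep G U \<Longrightarrow> irr_iso_rel G `` {U} \<in> Irr G"
  unfolding Irr_def by (rule quotientI) simp

lemma class_mem: "irreducible_rep G U \<Longrightarrow> U \<in> irr_iso_rel G `` {U}"
  by (simp add: irr_iso_rel_def rep_iso_refl irr_is_rep)

lemma Irr_mem_unique:
  "\<rho> \<in> Irr G \<Longrightarrow> \<sigma> \<in> Irr G \<Longrightarrow> U \<in> \<rho> \<Longrightarrow> U \<in> \<sigma> \<Longrightarrow> \<rho> = \<sigma>"
  using quotient_disj[OF equiv_irr_iso_rel] by (auto simp: Irr_def)

lemma irr_dim_pos: "\<rho> \<in> Irr G \<Longrightarrow> irr_dim \<rho> > 0"
  using irreducible_representative by (simp add: irr_dim_def irreducible_rep_def)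

lemma irr_character_mem:
  assumes "\<rho> \<in> Irr G" "U \<in> \<rho>" "g \<in> carrier G" shows "character U g = irr_character \<rho> g"
  using Irr_mem_iff[OF assms(1) Irr_memD[OF assms(1,2)]] assms
  by (auto simp: irr_character_def intro: character_cong_iso)

lemma irr_character_pairing:
  assumes \<rho>: "\<rho> \<in> Irr G" and U: "irreducible_rep G U"
  shows "char_pairing (character U) (irr_character \<rho>) = (if U \<in> \<rho> then 1 else 0)"
proof -
  let ?R = "representative \<rho>"
  note R = irreducible_representative[OF \<rho>]
  show ?thesis
  proof (cases "U \<in> \<rho>")
    case True
    have "char_pairing (character U) (irr_character \<rho>) = char_pairing (character ?R) (character ?R)"
      by (rule char_pairing_cong) (use irr_character_mem[OF \<rho> True] in \<open>auto simp: irr_character_def\<close>)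
    then show ?thesis using True character_norm[OF R] by simp
  next
    case False
    then have "\<not> rep_iso G ?R U" using Irr_mem_iff[OF \<rho> U] rep_iso_sym by blast
    then show ?thesis using False character_orthogonal[OF R U] by (simp add: irr_character_def)
  qed
qed

lemma irr_character_orthonormal:
  assumes "\<rho> \<in> Irr G" "\<sigma> \<in> Irr G"
  shows "char_pairing (irr_character \<sigma>) (irr_character \<rho>) = (if \<sigma> = \<rho> then 1 else 0)"
  using irr_character_pairing[OF assms(1) irreducible_representative[OF assms(2)]]
    Irr_mem_unique[OF assms(2,1) representative_mem[OF assms(2)]] representative_mem[OF assms(1)]
  by (auto simp: irr_character_def)

lemma char_pairing_sum_list:
  "char_pairing (\<lambda>g. \<Sum>U\<leftarrow>Us. f U g) \<psi> = (\<Sum>U\<leftarrow>Us. char_pairing (f U) \<psi>)"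
  by (induction Us) (simp_all add: char_pairing_def distrib_right sum.distrib add_divide_distrib)

text \<open>The number of summands in a class is determined by the character. This is what makes the
multiplicity well defined.\<close>

lemma decomposition_count:
  assumes \<rho>: "\<rho> \<in> Irr G" and Us: "\<forall>U \<in> set Us. irreducible_rep G U"
    and iso: "rep_iso G V (direct_sum_rep Us)"
  shows "of_nat (length (filter (\<lambda>U. U \<in> \<rho>) Us)) = char_pairing (character V) (irr_character \<rho>)"
proof -
  have "char_pairing (character V) (irr_character \<rho>)
      = char_pairing (\<lambda>g. \<Sum>U\<leftarrow>Us. character U g) (irr_character \<rho>)"
    by (rule char_pairing_cong) (use Us in \<open>simp_all add: character_cong_iso[OF iso] character_direct_sum irr_is_rep\<close>)
  also have "\<dots> = (\<Sum>U\<leftarrow>Us. char_pairing (character U) (irr_character \<rho>))" by (rule char_pairing_sum_list)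
  also have "\<dots> = of_nat (length (filter (\<lambda>U. U \<in> \<rho>) Us))"
    using Us by (induction Us) (simp_all add: irr_character_pairing[OF \<rho>])
  finally show ?thesis ..
qed

lemma multiplicity_decomposition:
  assumes \<rho>: "\<rho> \<in> Irr G" and Us: "\<forall>U \<in> set Us. irreducible_rep G U"
    and iso: "rep_iso G V (direct_sum_rep Us)"
  shows "multiplicity_in G \<rho> V = length (filter (\<lambda>U. U \<in> \<rho>) Us)"
  unfolding multiplicity_in_def
proof (rule the_equality)
  show "\<exists>Us'. (\<forall>U\<in>set Us'. irreducible_rep G U) \<and> rep_iso G V (direct_sum_rep Us') \<and>
      length (filter (\<lambda>U. U \<in> \<rho>) Us) = length (filter (\<lambda>U. U \<in> \<rho>) Us')"
    using Us iso by blast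
  fix m assume "\<exists>Us. (\<forall>U\<in>set Us. irreducible_rep G U) \<and> rep_iso G V (direct_sum_rep Us) \<and>
      m = length (filter (\<lambda>U. U \<in> \<rho>) Us)"
  then obtain Us' where Us': "\<forall>U\<in>set Us'. irreducible_rep G U" "rep_iso G V (direct_sum_rep Us')"
    and m: "m = length (filter (\<lambda>U. U \<in> \<rho>) Us')"
    by blast
  have "(of_nat m :: complex) = of_nat (length (filter (\<lambda>U. U \<in> \<rho>) Us))"
    unfolding m decomposition_count[OF \<rho> Us'] decomposition_count[OF \<rho> Us iso] ..
  then show "m = length (filter (\<lambda>U. U \<in> \<rho>) Us)" by (simp only: of_nat_eq_iff)
qed

text \<open>Orthonormality says that the table of character values has a right inverse, so it cannot have
more rows than columns.\<close>

lemma card_Irr_subset_le: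
  assumes S: "S \<subseteq> Irr G" "finite S"
  shows "card S \<le> order G"
proof -
  obtain xs where xs: "set xs = S" "distinct xs" using finite_distinct_list[OF S(2)] by blast
  obtain gs where gs: "set gs = carrier G" "distinct gs" using finite_distinct_list[OF fin] by blast
  let ?n = "length xs" and ?m = "length gs"
  have n: "?n = card S" and m: "?m = order G"
    using distinct_card[OF xs(2)] distinct_card[OF gs(2)] xs gs by (simp_all add: order_def)
  define A where "A = mat ?n ?m (\<lambda>(i, a). irr_character (xs ! i) (gs ! a))"
  define B where "B = mat ?m ?n (\<lambda>(a, i). irr_character (xs ! i) (inv (gs ! a)) / of_nat (order G))"
  have A: "A \<in> carrier_mat ?n ?m" and B: "B \<in> carrier_mat ?m ?n" by (simp_all add: A_def B_def)
  have "A * B = 1\<^sub>m ?n"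
  proof (rule eq_matI)
    fix i j assume "i < dim_row (1\<^sub>m ?n :: complex mat)" "j < dim_col (1\<^sub>m ?n :: complex mat)"
    then have ij: "i < ?n" "j < ?n" by auto
    then have mem: "xs ! i \<in> Irr G" "xs ! j \<in> Irr G" using S xs nth_mem by blast+
    have "(A * B) $$ (i, j) = (\<Sum>a<?m. A $$ (i, a) * B $$ (a, j))" by (rule index_mult_mat_sum[OF A B ij])
    also have "\<dots> = (\<Sum>a<?m. irr_character (xs ! i) (gs ! a) * irr_character (xs ! j) (inv (gs ! a)) / of_nat (order G))"
      using ij by (intro sum.cong) (auto simp: A_def B_def)
    also have "\<dots> = (\<Sum>g\<in>carrier G. irr_character (xs ! i) g * irr_character (xs ! j) (inv g) / of_nat (order G))"
      by (rule sum.reindex_bij_betw[OF bij_betw_nth]) (use gs in auto)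
    also have "\<dots> = char_pairing (irr_character (xs ! i)) (irr_character (xs ! j))"
      by (simp add: char_pairing_def sum_divide_distrib)
    also have "\<dots> = 1\<^sub>m ?n $$ (i, j)"
      using ij mem by (simp add: irr_character_orthonormal nth_eq_iff_index_eq[OF xs(2)])
    finally show "(A * B) $$ (i, j) = 1\<^sub>m ?n $$ (i, j)" .
  qed (use A B in auto)
  from card_le_of_right_inverse[OF A B this] show ?thesis by (simp add: n m)
qed

lemma finite_Irr: "finite (Irr G)"
  using finite_if_finite_subsets_card_bdd[of "Irr G" "order G"] card_Irr_subset_le by blast

lemma character_expansion:
  assumes V: "is_rep G V" and g: "g \<in> carrier G"
  shows "character V g = (\<Sum>\<rho>\<in>Irr G. of_nat (multiplicity_in G \<rho> V) * irr_character \<rho> g)"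
proof -
  obtain Us where Us: "\<forall>U \<in> set Us. irreducible_rep G U" and iso: "rep_iso G V (direct_sum_rep Us)"
    using complete_reducibility[OF V] by blast
  have one: "(\<Sum>\<rho>\<in>Irr G. (if U \<in> \<rho> then irr_character \<rho> g else 0)) = character U g"
    if U: "irreducible_rep G U" for U
  proof -
    let ?\<rho> = "irr_iso_rel G `` {U}"
    have "(\<Sum>\<rho>\<in>Irr G. (if U \<in> \<rho> then irr_character \<rho> g else 0))
        = (\<Sum>\<rho>\<in>Irr G. (if \<rho> = ?\<rho> then irr_character ?\<rho> g else 0))"
    proof (rule sum.cong[OF refl])
      fix \<rho> assume "\<rho> \<in> Irr G"
      then have "U \<in> \<rho> \<longleftrightarrow> \<rho> = ?\<rho>"
        using class_mem[OF U] Irr_mem_unique[OF _ class_in_Irr[OF U]] by metis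
      then show "(if U \<in> \<rho> then irr_character \<rho> g else 0) = (if \<rho> = ?\<rho> then irr_character ?\<rho> g else 0)"
        by simp
    qed
    also have "\<dots> = irr_character ?\<rho> g" by (simp only: sum.delta[OF finite_Irr] class_in_Irr[OF U] if_True)
    also have "\<dots> = character U g" using irr_character_mem[OF class_in_Irr[OF U] class_mem[OF U] g] ..
    finally show ?thesis .
  qed
  have "(\<Sum>U\<leftarrow>Us. character U g)
      = (\<Sum>\<rho>\<in>Irr G. of_nat (length (filter (\<lambda>U. U \<in> \<rho>) Us)) * irr_character \<rho> g)"
    using Us
  proof (induction Us)
    case (Cons U Us)
    have "(\<Sum>\<rho>\<in>Irr G. of_nat (length (filter (\<lambda>U. U \<in> \<rho>) (U # Us))) * irr_character \<rho> g)
        = (\<Sum>\<rho>\<in>Irr G. (if U \<in> \<rho> then irr_character \<rho> g else 0)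
            + of_nat (length (filter (\<lambda>U. U \<in> \<rho>) Us)) * irr_character \<rho> g)"
      by (intro sum.cong) (auto simp: distrib_right)
    then show ?case using Cons one[of U] by (simp add: sum.distrib)
  qed simp
  then show ?thesis
    using Us by (simp add: character_cong_iso[OF iso g] character_direct_sum[OF _ g] irr_is_rep
      multiplicity_decomposition[OF _ Us iso])
qed

section \<open>The Markov chain\<close>

lemma trivial_irr_in_Irr: "trivial_irr G \<in> Irr G"
  unfolding trivial_irr_def by (rule class_in_Irr[OF irreducible_trivial])

lemma irr_character_trivial: "g \<in> carrier G \<Longrightarrow> irr_character (trivial_irr G) g = 1"
  using irr_character_mem[OF trivial_irr_in_Irr, of trivial_rep g] class_mem[OF irreducible_trivial]
  by (simp add: trivial_irr_def character_def trivial_rep_def)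

lemma irr_dim_trivial: "irr_dim (trivial_irr G) = 1"
proof -
  have "(of_nat (irr_dim (trivial_irr G)) :: complex) = irr_character (trivial_irr G) \<one>"
    using character_one[OF irr_is_rep[OF irreducible_representative[OF trivial_irr_in_Irr]]]
    by (simp add: irr_dim_def irr_character_def)
  also have "\<dots> = of_nat 1" by (simp add: irr_character_trivial)
  finally show ?thesis by (simp only: of_nat_eq_iff)
qed

text \<open>The induction step is the expansion of the character of \<open>\<sigma> \<otimes> \<eta>\<close> into irreducible characters: the factor
\<open>d\<^sub>\<rho>\<close> of the transition probability cancels against the division by \<open>d\<^sub>\<rho>\<close>. Initially only the trivial
representation contributes, with character \<open>1\<close>.\<close>

lemma transition_steps_generating:
  assumes \<eta>: "is_rep G \<eta>" and g: "g \<in> carrier G"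
  shows "(\<Sum>\<sigma>\<in>Irr G. complex_of_real (transition_steps G \<eta> r (trivial_irr G) \<sigma> / irr_dim \<sigma>) * irr_character \<sigma> g)
    = (character \<eta> g / of_nat (fst \<eta>)) ^ r"
proof (induction r)
  case 0
  have "(\<Sum>\<sigma>\<in>Irr G. complex_of_real (transition_steps G \<eta> 0 (trivial_irr G) \<sigma> / irr_dim \<sigma>) * irr_character \<sigma> g)
      = (\<Sum>\<sigma>\<in>Irr G. if \<sigma> = trivial_irr G then 1 else 0)"
    using g by (intro sum.cong) (auto simp: irr_dim_trivial irr_character_trivial)
  also have "\<dots> = 1" using finite_Irr trivial_irr_in_Irr by simp
  finally show ?case by simp
next
  case (Suc r)
  let ?t = "\<lambda>\<sigma>. complex_of_real (transition_steps G \<eta> r (trivial_irr G) \<sigma>)"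
  let ?m = "\<lambda>\<sigma> \<rho>. multiplicity_in G \<rho> (tensor_rep (representative \<sigma>) \<eta>)"
  let ?d = "of_nat (fst \<eta>) :: complex"
  have "(\<Sum>\<rho>\<in>Irr G. complex_of_real (transition_steps G \<eta> (Suc r) (trivial_irr G) \<rho> / irr_dim \<rho>) * irr_character \<rho> g)
      = (\<Sum>\<rho>\<in>Irr G. \<Sum>\<sigma>\<in>Irr G. ?t \<sigma> / of_nat (irr_dim \<sigma>) / ?d * (of_nat (?m \<sigma> \<rho>) * irr_character \<rho> g))"
  proof (rule sum.cong[OF refl])
    fix \<rho> assume \<rho>: "\<rho> \<in> Irr G"
    have "complex_of_real (transition_steps G \<eta> (Suc r) (trivial_irr G) \<rho> / irr_dim \<rho>)
        = (\<Sum>\<sigma>\<in>Irr G. ?t \<sigma> / of_nat (irr_dim \<sigma>) / ?d * of_nat (?m \<sigma> \<rho>))"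
      using irr_dim_pos[OF \<rho>] by (simp add: sum_divide_distrib transition_def)
    then show "complex_of_real (transition_steps G \<eta> (Suc r) (trivial_irr G) \<rho> / irr_dim \<rho>) * irr_character \<rho> g
        = (\<Sum>\<sigma>\<in>Irr G. ?t \<sigma> / of_nat (irr_dim \<sigma>) / ?d * (of_nat (?m \<sigma> \<rho>) * irr_character \<rho> g))"
      by (simp add: sum_distrib_right mult.assoc)
  qed
  also have "\<dots> = (\<Sum>\<sigma>\<in>Irr G. ?t \<sigma> / of_nat (irr_dim \<sigma>) / ?d * (\<Sum>\<rho>\<in>Irr G. of_nat (?m \<sigma> \<rho>) * irr_character \<rho> g))"
    by (subst sum.swap) (simp add: sum_distrib_left)
  also have "\<dots> = (\<Sum>\<sigma>\<in>Irr G. complex_of_real (transition_steps G \<eta> r (trivial_irr G) \<sigma> / irr_dim \<sigma>)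
      * irr_character \<sigma> g * (character \<eta> g / ?d))"
  proof (rule sum.cong[OF refl])
    fix \<sigma> assume \<sigma>: "\<sigma> \<in> Irr G"
    note R = irr_is_rep[OF irreducible_representative[OF \<sigma>]]
    have "(\<Sum>\<rho>\<in>Irr G. of_nat (?m \<sigma> \<rho>) * irr_character \<rho> g) = irr_character \<sigma> g * character \<eta> g"
      using character_expansion[OF is_rep_tensor[OF R \<eta>] g] character_tensor[OF R \<eta> g]
      by (simp add: irr_character_def)
    then show "?t \<sigma> / of_nat (irr_dim \<sigma>) / ?d * (\<Sum>\<rho>\<in>Irr G. of_nat (?m \<sigma> \<rho>) * irr_character \<rho> g)
      = complex_of_real (transition_steps G \<eta> r (trivial_irr G) \<sigma> / irr_dim \<sigma>)
      * irr_character \<sigma> g * (character \<eta> g / ?d)" by simp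
  qed
  also have "\<dots> = (character \<eta> g / ?d) ^ Suc r"
    by (simp only: sum_distrib_right[symmetric] Suc.IH power_Suc2)
  finally show ?case .
qed

text \<open>Pairing the previous identity with \<open>\<chi>\<^sup>\<Lambda>\<close> isolates \<open>K\<^sup>r(1,\<Lambda>) / d\<^sub>\<Lambda>\<close>. Passing to the quotient by the
Plancherel measure multiplies it by \<open>|G| / d\<^sub>\<Lambda>\<close>.\<close>

theorem transition_steps_over_plancherel:
  assumes \<eta>: "is_rep G \<eta>" and \<Lambda>: "\<Lambda> \<in> Irr G"
  shows "complex_of_real (transition_steps G \<eta> r (trivial_irr G) \<Lambda> / plancherel G \<Lambda>)
    = (\<Sum>g\<in>carrier G. (character \<eta> g / of_nat (fst \<eta>)) ^ r * irr_character \<Lambda> (inv g)) / of_nat (irr_dim \<Lambda>)"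
proof -
  let ?f = "\<lambda>\<sigma>. complex_of_real (transition_steps G \<eta> r (trivial_irr G) \<sigma> / irr_dim \<sigma>)"
  have "(\<Sum>g\<in>carrier G. (character \<eta> g / of_nat (fst \<eta>)) ^ r * irr_character \<Lambda> (inv g))
      = (\<Sum>g\<in>carrier G. \<Sum>\<sigma>\<in>Irr G. ?f \<sigma> * (irr_character \<sigma> g * irr_character \<Lambda> (inv g)))"
    by (intro sum.cong refl) (simp only: transition_steps_generating[OF \<eta>, symmetric] sum_distrib_right mult.assoc)
  also have "\<dots> = (\<Sum>\<sigma>\<in>Irr G. ?f \<sigma> * (\<Sum>g\<in>carrier G. irr_character \<sigma> g * irr_character \<Lambda> (inv g)))"
    by (subst sum.swap) (simp only: sum_distrib_left)
  also have "\<dots> = (\<Sum>\<sigma>\<in>Irr G. ?f \<sigma> * (of_nat (order G) * char_pairing (irr_character \<sigma>) (irr_character \<Lambda>)))"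
    using order_pos by (simp add: char_pairing_def)
  also have "\<dots> = (\<Sum>\<sigma>\<in>Irr G. if \<sigma> = \<Lambda> then ?f \<Lambda> * of_nat (order G) else 0)"
    by (intro sum.cong refl) (simp add: irr_character_orthonormal[OF \<Lambda>])
  also have "\<dots> = ?f \<Lambda> * of_nat (order G)" using finite_Irr \<Lambda> by simp
  finally show ?thesis using irr_dim_pos[OF \<Lambda>] order_pos
    by (simp add: plancherel_def power2_eq_square field_simps)
qed

end

section \<open>Pointwise stabilisers in the general linear group\<close>

lemma finite_carrier_mat: "finite (carrier_mat n m :: 'f::finite mat set)"
proof (rule finite_subset)
  show "(carrier_mat n m :: 'f mat set) \<subseteq> mat n m ` (({..<n} \<times> {..<m}) \<rightarrow>\<^sub>E UNIV)"
  proof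
    fix A :: "'f mat" assume "A \<in> carrier_mat n m"
    then have "A = mat n m (restrict (($$) A) ({..<n} \<times> {..<m}))" by (intro eq_matI) auto
    moreover have "restrict (($$) A) ({..<n} \<times> {..<m}) \<in> ({..<n} \<times> {..<m}) \<rightarrow>\<^sub>E UNIV" by simp
    ultimately show "A \<in> mat n m ` (({..<n} \<times> {..<m}) \<rightarrow>\<^sub>E UNIV)" by (rule image_eqI)
  qed
qed (intro finite_imageI finite_PiE; simp)

lemma fin_group_GL: "fin_group (GL TYPE('f::{field,finite}) n)"
proof (intro fin_group.intro fin_group_axioms.intro)
  interpret R: ring "ring_mat TYPE('f) n ()" by (rule ring_mat)
  show "group (GL TYPE('f) n)" unfolding GL_def by (rule R.units_group)
  show "finite (carrier (GL TYPE('f) n))"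
    by (rule finite_subset[OF _ finite_carrier_mat[of n n]]) (auto simp: GL_carrier)
qed

lemma GL_one: "one (GL TYPE('f::semiring_1) n) = 1\<^sub>m n"
  by (simp add: GL_def units_of_def ring_mat_simps)

lemma card_linear_subset:
  assumes W: "linear_subset n (W :: 'f::{field,finite} vec set)"
  shows "card W = CARD('f) ^ subspace_dim n W"
proof -
  have "vectorspace class_ring ((module_vec TYPE('f) n)\<lparr>carrier := W\<rparr>)"
    using W by (intro vectorspace.subspace_is_vs[OF vec_vs]) (simp add: subspace_module_vec_iff)
  moreover have "finite W"
    using W by (intro finite_subset[OF _ finite_carrier_vec'[of n]]) (simp add: linear_subset_def)
  ultimately show ?thesis using card_vectorspace by (fastforce simp: subspace_dim_def)
qed

lemma linear_subset_fixed_space: "g \<in> carrier_mat n n \<Longrightarrow> linear_subset n (fixed_space n g)"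
  by (auto simp: linear_subset_def fixed_space_def mult_add_distrib_mat_vec mult_mat_vec)

lemma card_fixed_space:
  "g \<in> carrier_mat n n \<Longrightarrow> card (fixed_space n g) = CARD('f) ^ fixed_dim n g" for g :: "'f::{field,finite} mat"
  unfolding fixed_dim_def by (intro card_linear_subset linear_subset_fixed_space)

lemma fixed_space_inverse:
  assumes "g \<in> carrier_mat n n" "h \<in> carrier_mat n n" "h * g = 1\<^sub>m n" "g * h = 1\<^sub>m n"
  shows "fixed_space n h = fixed_space n (g :: 'f::field mat)"
  using mult_mat_vec_cancel[OF assms(1,2,3)] mult_mat_vec_cancel[OF assms(2,1,4)]
  unfolding fixed_space_def by metis

lemma card_initial_coordinates:
  assumes "k \<le> n"
  shows "card {v \<in> carrier_vec n. \<forall>i. k \<le> i \<and> i < n \<longrightarrow> v $ i = (0 :: 'f::{field,finite})} = CARD('f) ^ k"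
proof -
  let ?Z = "{v \<in> carrier_vec n. \<forall>i. k \<le> i \<and> i < n \<longrightarrow> v $ i = (0 :: 'f)}"
  have "bij_betw (\<lambda>f. vec n (\<lambda>i. if i < k then f i else 0)) ({..<k} \<rightarrow>\<^sub>E UNIV) ?Z"
  proof (rule bij_betw_byWitness[where f' = "\<lambda>v. restrict (($) v) {..<k}"])
    show "\<forall>f\<in>{..<k} \<rightarrow>\<^sub>E (UNIV :: 'f set). restrict (($) (vec n (\<lambda>i. if i < k then f i else 0))) {..<k} = f"
    proof
      fix f :: "nat \<Rightarrow> 'f" assume f: "f \<in> {..<k} \<rightarrow>\<^sub>E UNIV"
      show "restrict (($) (vec n (\<lambda>i. if i < k then f i else 0))) {..<k} = f"
      proof
        fix i show "restrict (($) (vec n (\<lambda>i. if i < k then f i else 0))) {..<k} i = f i"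
          using assms PiE_arb[OF f, of i] by (cases "i < k") auto
      qed
    qed
    show "\<forall>v\<in>?Z. vec n (\<lambda>i. if i < k then restrict (($) v) {..<k} i else 0) = v"
      by (auto intro!: eq_vecI)
    show "(\<lambda>f. vec n (\<lambda>i. if i < k then f i else 0)) ` ({..<k} \<rightarrow>\<^sub>E UNIV) \<subseteq> ?Z"
      by (intro image_subsetI) simp
    show "(\<lambda>v. restrict (($) v) {..<k}) ` ?Z \<subseteq> {..<k} \<rightarrow>\<^sub>E UNIV"
      by (intro image_subsetI) simp
  qed
  from bij_betw_same_card[OF this] show ?thesis by (simp add: card_PiE)
qed

lemma card_field_ge_2: "CARD('f::{field,finite}) \<ge> 2"
  using card_mono[of "UNIV :: 'f set" "{0, 1}"] by simp

text \<open>Over a finite field the dimension can be read off from the cardinality, which coordinates preserve.\<close>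

lemma subspace_dim_adapted:
  fixes S T :: "'f::{field,finite} mat"
  assumes W: "linear_subset n W" and S: "S \<in> carrier_mat n n" and T: "T \<in> carrier_mat n n"
    and ST: "S * T = 1\<^sub>m n" and TS: "T * S = 1\<^sub>m n" and k: "k \<le> n"
    and Weq: "W = {v \<in> carrier_vec n. \<forall>i. k \<le> i \<and> i < n \<longrightarrow> (T *\<^sub>v v) $ i = 0}"
  shows "subspace_dim n W = k"
proof -
  have "bij_betw ((*\<^sub>v) T) W {v \<in> carrier_vec n. \<forall>i. k \<le> i \<and> i < n \<longrightarrow> v $ i = 0}"
  proof (rule bij_betw_byWitness[where f' = "(*\<^sub>v) S"])
    show "\<forall>v\<in>W. S *\<^sub>v (T *\<^sub>v v) = v" using mult_mat_vec_cancel[OF T S ST] by (simp add: Weq)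
    show "\<forall>v\<in>{v \<in> carrier_vec n. \<forall>i. k \<le> i \<and> i < n \<longrightarrow> v $ i = 0}. T *\<^sub>v (S *\<^sub>v v) = v"
      using mult_mat_vec_cancel[OF S T TS] by simp
    show "(*\<^sub>v) T ` W \<subseteq> {v \<in> carrier_vec n. \<forall>i. k \<le> i \<and> i < n \<longrightarrow> v $ i = 0}"
      using T by (auto simp: Weq simp del: index_mult_mat_vec)
    show "(*\<^sub>v) S ` {v \<in> carrier_vec n. \<forall>i. k \<le> i \<and> i < n \<longrightarrow> v $ i = 0} \<subseteq> W"
      using S mult_mat_vec_cancel[OF S T TS] by (auto simp: Weq simp del: index_mult_mat_vec)
  qed
  from bij_betw_same_card[OF this] have "CARD('f) ^ subspace_dim n W = CARD('f) ^ k"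
    by (simp add: card_linear_subset[OF W] card_initial_coordinates[OF k])
  moreover have "CARD('f) > 1" using card_field_ge_2[where ?'f='f] by simp
  ultimately show ?thesis by (metis power_inject_exp)
qed

lemma fixes_initial_coordinates:
  fixes h :: "'f::field mat"
  assumes h: "h \<in> carrier_mat n n" and fixd: "\<And>i. i < k \<Longrightarrow> h *\<^sub>v unit_vec n i = unit_vec n i"
    and u: "u \<in> carrier_vec n" and z: "\<forall>i. k \<le> i \<and> i < n \<longrightarrow> u $ i = 0"
  shows "h *\<^sub>v u = u"
proof (rule eq_vecI)
  fix a assume "a < dim_vec u"
  then have a: "a < n" using u by simp
  have entry: "h $$ (a, j) = (if a = j then 1 else 0)" if j: "j < k" "j < n" for j
  proof -
    have "h $$ (a, j) = col h j $ a" using h a j by simp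
    also have "col h j = unit_vec n j" using col_eq_mult_unit_vec[OF h j(2)] fixd[OF j(1)] by simp
    finally show ?thesis using a j by simp
  qed
  have "(h *\<^sub>v u) $ a = (\<Sum>j<n. h $$ (a, j) * u $ j)" by (rule index_mult_mat_vec_sum[OF h u a])
  also have "\<dots> = (\<Sum>j<n. if j = a then u $ a else 0)"
  proof (rule sum.cong[OF refl])
    fix j assume "j \<in> {..<n}"
    then show "h $$ (a, j) * u $ j = (if j = a then u $ a else 0)"
      using entry[of j] z by (cases "j < k") auto
  qed
  also have "\<dots> = u $ a" using a by simp
  finally show "(h *\<^sub>v u) $ a = u $ a" .
qed (use h u in auto)

text \<open>Conjugation by a basis adapted to \<open>W\<close> carries the pointwise stabiliser of \<open>W\<close> to that of the first
\<open>dim W\<close> unit vectors, and characters do not change under conjugation.\<close>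

lemma sum_pointwise_stabilizer:
  fixes W :: "'f::{field,finite} vec set"
  assumes W: "linear_subset n W" and \<Lambda>: "\<Lambda> \<in> Irr (GL TYPE('f) n)"
  shows "(\<Sum>g | g \<in> carrier (GL TYPE('f) n) \<and> W \<subseteq> fixed_space n g. irr_character \<Lambda> g)
      = c_coeff n (subspace_dim n W) \<Lambda>"
    and "subspace_dim n W \<le> n"
proof -
  interpret G: fin_group "GL TYPE('f) n" by (rule fin_group_GL)
  let ?G = "carrier (GL TYPE('f) n)"
  obtain S T k where S: "S \<in> carrier_mat n n" and T: "T \<in> carrier_mat n n"
    and ST: "S * T = 1\<^sub>m n" and TS: "T * S = 1\<^sub>m n" and k: "k \<le> n"
    and Weq: "W = {v \<in> carrier_vec n. \<forall>i. k \<le> i \<and> i < n \<longrightarrow> (T *\<^sub>v v) $ i = 0}"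
    by (rule adapted_basis[OF W])
  have dim: "subspace_dim n W = k" by (rule subspace_dim_adapted[OF W S T ST TS k Weq])
  then show "subspace_dim n W \<le> n" using k by simp
  have SG: "S \<in> ?G" and TG: "T \<in> ?G" using S T ST TS by (auto simp: GL_carrier)
  have Gc: "g \<in> carrier_mat n n" if "g \<in> ?G" for g using that by (simp add: GL_carrier)
  have cl: "a * b \<in> ?G" if "a \<in> ?G" "b \<in> ?G" for a b using G.m_closed[OF that] by (simp add: GL_mult)
  note as = assoc_mult_mat[of _ n n _ n _ n]
  let ?H = "fixing_subgroup TYPE('f) n k"
  have fwd: "T * (g * S) \<in> ?H" if g: "g \<in> ?G" and gW: "W \<subseteq> fixed_space n g" for g
  proof -
    have "(T * (g * S)) *\<^sub>v unit_vec n i = unit_vec n i" if i: "i < k" for i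
    proof -
      let ?e = "unit_vec n i :: 'f vec"
      have e: "?e \<in> carrier_vec n" by simp
      have TSe: "T *\<^sub>v (S *\<^sub>v ?e) = ?e" by (rule mult_mat_vec_cancel[OF S T TS e])
      then have "S *\<^sub>v ?e \<in> W" unfolding Weq using S i k by auto
      then have gS: "g *\<^sub>v (S *\<^sub>v ?e) = S *\<^sub>v ?e" using gW by (auto simp: fixed_space_def)
      have "(T * (g * S)) *\<^sub>v ?e = T *\<^sub>v (g *\<^sub>v (S *\<^sub>v ?e))"
        using assoc_mult_mat_vec[OF T mult_carrier_mat[OF Gc[OF g] S] e]
          assoc_mult_mat_vec[OF Gc[OF g] S e] by simp
      then show ?thesis by (simp add: gS TSe)
    qed
    then show ?thesis using cl[OF TG cl[OF g SG]] by (simp add: fixing_subgroup_def)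
  qed
  have bwd: "S * (h * T) \<in> {g \<in> ?G. W \<subseteq> fixed_space n g}" if h: "h \<in> ?H" for h
  proof -
    have hG: "h \<in> ?G" and fixd: "\<And>i. i < k \<Longrightarrow> h *\<^sub>v unit_vec n i = unit_vec n i"
      using h by (auto simp: fixing_subgroup_def)
    have "(S * (h * T)) *\<^sub>v w = w" if w: "w \<in> W" for w
    proof -
      have wc: "w \<in> carrier_vec n" and z: "\<forall>i. k \<le> i \<and> i < n \<longrightarrow> (T *\<^sub>v w) $ i = 0"
        using w unfolding Weq by auto
      have "(S * (h * T)) *\<^sub>v w = S *\<^sub>v (h *\<^sub>v (T *\<^sub>v w))"
        using assoc_mult_mat_vec[OF S mult_carrier_mat[OF Gc[OF hG] T] wc]
          assoc_mult_mat_vec[OF Gc[OF hG] T wc] by simp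
      also have "h *\<^sub>v (T *\<^sub>v w) = T *\<^sub>v w"
        by (rule fixes_initial_coordinates[OF Gc[OF hG] fixd _ z]) (use T wc in auto)
      also have "S *\<^sub>v (T *\<^sub>v w) = w" by (rule mult_mat_vec_cancel[OF T S ST wc])
      finally show ?thesis .
    qed
    then show ?thesis using cl[OF SG cl[OF hG TG]] W by (auto simp: fixed_space_def linear_subset_def)
  qed
  have ST': "S * (T * X) = X" if "X \<in> carrier_mat n n" for X
  proof -
    have "S * (T * X) = (S * T) * X" using S T that by (simp add: as)
    then show ?thesis using that by (simp add: ST)
  qed
  have TS': "T * (S * X) = X" if "X \<in> carrier_mat n n" for X
  proof -
    have "T * (S * X) = (T * S) * X" using S T that by (simp add: as)
    then show ?thesis using that by (simp add: TS)
  qed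
  have bij: "bij_betw (\<lambda>g. T * (g * S)) {g \<in> ?G. W \<subseteq> fixed_space n g} ?H"
  proof (rule bij_betw_byWitness[where f' = "\<lambda>h. S * (h * T)"])
    show "\<forall>g\<in>{g \<in> ?G. W \<subseteq> fixed_space n g}. S * ((T * (g * S)) * T) = g"
    proof
      fix g assume "g \<in> {g \<in> ?G. W \<subseteq> fixed_space n g}"
      then have g: "g \<in> carrier_mat n n" using Gc by blast
      have "S * ((T * (g * S)) * T) = S * (T * (g * (S * T)))" using S T g by (simp add: as)
      then show "S * ((T * (g * S)) * T) = g" using g by (simp add: ST ST')
    qed
    show "\<forall>h\<in>?H. T * ((S * (h * T)) * S) = h"
    proof
      fix h assume "h \<in> ?H"
      then have h: "h \<in> carrier_mat n n" using Gc by (auto simp: fixing_subgroup_def)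
      have "T * ((S * (h * T)) * S) = T * (S * (h * (T * S)))" using S T h by (simp add: as)
      then show "T * ((S * (h * T)) * S) = h" using h by (simp add: TS TS')
    qed
  qed (use fwd bwd in auto)
  note R = G.irr_is_rep[OF G.irreducible_representative[OF \<Lambda>]]
  have "c_coeff n k \<Lambda> = (\<Sum>g | g \<in> ?G \<and> W \<subseteq> fixed_space n g. irr_character \<Lambda> (T * (g * S)))"
    unfolding c_coeff_def by (rule sum.reindex_bij_betw[OF bij, symmetric])
  also have "\<dots> = (\<Sum>g | g \<in> ?G \<and> W \<subseteq> fixed_space n g. irr_character \<Lambda> g)"
  proof (rule sum.cong[OF refl])
    fix g assume "g \<in> {g. g \<in> ?G \<and> W \<subseteq> fixed_space n g}"
    then have g: "g \<in> ?G" by simp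
    show "irr_character \<Lambda> (T * (g * S)) = irr_character \<Lambda> g"
      unfolding irr_character_def
      by (rule G.character_conjugate[OF R SG g cl[OF TG cl[OF g SG]]])
        (use ST' mult_carrier_mat[OF Gc[OF g] S] in \<open>simp add: GL_mult\<close>)
  qed
  finally show "(\<Sum>g | g \<in> ?G \<and> W \<subseteq> fixed_space n g. irr_character \<Lambda> g)
      = c_coeff n (subspace_dim n W) \<Lambda>" by (simp add: dim)
qed

section \<open>Random tuples of vectors\<close>

lemma replicate_pmf_of_set:
  assumes A: "finite A" "A \<noteq> {}"
  shows "replicate_pmf r (pmf_of_set A) = pmf_of_set {xs. set xs \<subseteq> A \<and> length xs = r}"
proof (rule pmf_eqI)
  let ?L = "\<lambda>r. {xs. set xs \<subseteq> A \<and> length xs = r}"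
  have fin: "finite (?L r)" for r by (rule finite_lists_length_eq[OF A(1)])
  have ne: "?L r \<noteq> {}" for r
  proof -
    obtain a where "a \<in> A" using A by blast
    then have "replicate r a \<in> ?L r" by auto
    then show ?thesis by blast
  qed
  fix ys
  show "pmf (replicate_pmf r (pmf_of_set A)) ys = pmf (pmf_of_set (?L r)) ys"
  proof (induction r arbitrary: ys)
    case 0
    have "?L 0 = {[]}" by auto
    then show ?case by (simp add: pmf_of_set_singleton)
  next
    case (Suc r)
    have IH: "replicate_pmf r (pmf_of_set A) = pmf_of_set (?L r)" using Suc.IH by (rule pmf_eqI)
    have eq: "replicate_pmf (Suc r) (pmf_of_set A)
        = map_pmf (\<lambda>(x, xs). x # xs) (pair_pmf (pmf_of_set A) (pmf_of_set (?L r)))"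
      by (simp add: IH pair_pmf_def map_bind_pmf)
    have inj: "inj (\<lambda>(x, xs). x # xs :: 'a list)" by (auto simp: inj_on_def)
    show ?case
    proof (cases ys)
      case Nil
      have "[] \<notin> set_pmf (map_pmf (\<lambda>(x, xs). x # xs) (pair_pmf (pmf_of_set A) (pmf_of_set (?L r))))"
        by auto
      then have "pmf (replicate_pmf (Suc r) (pmf_of_set A)) [] = 0"
        unfolding eq by (rule iffD2[OF pmf_eq_0_set_pmf])
      then show ?thesis unfolding Nil using fin[of "Suc r"] ne[of "Suc r"] by simp
    next
      case (Cons x xs)
      have "pmf (replicate_pmf (Suc r) (pmf_of_set A)) (x # xs)
          = pmf (pair_pmf (pmf_of_set A) (pmf_of_set (?L r))) (x, xs)"
        unfolding eq using pmf_map_inj'[OF inj, of _ "(x, xs)"] by simp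
      also have "\<dots> = pmf (pmf_of_set (?L (Suc r))) (x # xs)"
        using fin ne A by (simp add: pmf_pair card_lists_length_eq indicator_def)
      finally show ?thesis unfolding Cons .
    qed
  qed
qed

lemma fixes_span_iff:
  fixes g :: "'f::field mat"
  assumes g: "g \<in> carrier_mat n n" and vs: "X \<subseteq> carrier_vec n"
  shows "LinearCombinations.module.span class_ring (module_vec TYPE('f) n) X \<subseteq> fixed_space n g
    \<longleftrightarrow> X \<subseteq> fixed_space n g"
proof -
  interpret V: vectorspace "class_ring :: 'f ring" "module_vec TYPE('f) n" by (rule vec_vs)
  have "submodule class_ring (fixed_space n g) (module_vec TYPE('f) n)"
    using linear_subset_fixed_space[OF g]
    by (simp add: subspace_module_vec_iff[symmetric] VectorSpace.subspace_def)
  then show ?thesis using V.span_is_subset[of X "fixed_space n g"] V.in_own_span[of X] vs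
    by (auto simp: module_vec_simps)
qed

lemma linear_subset_span:
  assumes "X \<subseteq> carrier_vec n"
  shows "linear_subset n (LinearCombinations.module.span class_ring (module_vec TYPE('f::field) n) X)"
proof -
  interpret V: vectorspace "class_ring :: 'f ring" "module_vec TYPE('f) n" by (rule vec_vs)
  show ?thesis unfolding subspace_module_vec_iff[symmetric]
    by (rule V.span_is_subspace) (use assms in \<open>simp add: module_vec_simps\<close>)
qed

text \<open>Written as a double sum over vector tuples and group elements, the left-hand side collects for
each \<open>g\<close> the tuples whose span, equivalently whose entries, \<open>g\<close> fixes. There are \<open>q ^ (r * d(g))\<close> of them.\<close>

lemma sum_prob_span_dim:
  assumes \<Lambda>: "\<Lambda> \<in> Irr (GL TYPE('f::{field,finite}) n)"
  shows "(\<Sum>a = 0..n. complex_of_real (prob_span_dim TYPE('f) a r n) * c_coeff n a \<Lambda>)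
    = (\<Sum>g\<in>carrier (GL TYPE('f) n).
        (of_nat (CARD('f) ^ fixed_dim n g) / of_nat (card (carrier_vec n :: 'f vec set))) ^ r * irr_character \<Lambda> g)"
proof -
  interpret G: fin_group "GL TYPE('f) n" by (rule fin_group_GL)
  let ?G = "carrier (GL TYPE('f) n)"
  let ?V = "carrier_vec n :: 'f vec set"
  define L where "L = {vs. set vs \<subseteq> ?V \<and> length vs = r}"
  define sp where "sp vs = LinearCombinations.module.span class_ring (module_vec TYPE('f) n) (set vs)" for vs
  define dm where "dm vs = subspace_dim n (sp vs)" for vs
  have finL: "finite L" unfolding L_def by (rule finite_lists_length_eq[OF finite_carrier_vec'])
  have cardL: "card L = card ?V ^ r" unfolding L_def by (rule card_lists_length_eq[OF finite_carrier_vec'])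
  have Vne: "?V \<noteq> {}" by (metis empty_iff zero_carrier_vec)
  have Lne: "L \<noteq> {}" using cardL finL Vne finite_carrier_vec'[of n, where ?'f='f]
    by (metis card_0_eq power_not_zero card.empty)
  have lin: "linear_subset n (sp vs)" if "vs \<in> L" for vs
    unfolding sp_def by (rule linear_subset_span) (use that in \<open>simp add: L_def\<close>)
  have prob: "prob_span_dim TYPE('f) a r n = real (card {vs \<in> L. dm vs = a}) / real (card L)" for a
    unfolding prob_span_dim_def replicate_pmf_of_set[OF finite_carrier_vec' Vne]
      measure_pmf_of_set[OF Lne[unfolded L_def] finL[unfolded L_def]]
    by (simp add: L_def dm_def sp_def Int_def conj_ac)
  have inner: "c_coeff n (dm vs) \<Lambda> = (\<Sum>g\<in>?G. if set vs \<subseteq> fixed_space n g then irr_character \<Lambda> g else 0)"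
    if vs: "vs \<in> L" for vs
  proof -
    have "c_coeff n (dm vs) \<Lambda> = (\<Sum>g | g \<in> ?G \<and> sp vs \<subseteq> fixed_space n g. irr_character \<Lambda> g)"
      unfolding dm_def by (rule sum_pointwise_stabilizer(1)[OF lin[OF vs] \<Lambda>, symmetric])
    also have "{g. g \<in> ?G \<and> sp vs \<subseteq> fixed_space n g} = {g \<in> ?G. set vs \<subseteq> fixed_space n g}"
      using vs fixes_span_iff[of _ n "set vs"] by (auto simp: sp_def L_def GL_carrier)
    finally show ?thesis by (simp add: sum.inter_filter[OF G.fin])
  qed
  have "(\<Sum>a = 0..n. complex_of_real (prob_span_dim TYPE('f) a r n) * c_coeff n a \<Lambda>)
      = (\<Sum>a = 0..n. \<Sum>vs | vs \<in> L \<and> dm vs = a. c_coeff n (dm vs) \<Lambda>) / of_nat (card L)"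
    by (simp add: prob sum_divide_distrib)
  also have "(\<Sum>a = 0..n. \<Sum>vs | vs \<in> L \<and> dm vs = a. c_coeff n (dm vs) \<Lambda>) = (\<Sum>vs\<in>L. c_coeff n (dm vs) \<Lambda>)"
    by (rule sum.group[OF finL]) (use sum_pointwise_stabilizer(2)[OF lin \<Lambda>] in \<open>auto simp: dm_def\<close>)
  also have "\<dots> = (\<Sum>vs\<in>L. \<Sum>g\<in>?G. if set vs \<subseteq> fixed_space n g then irr_character \<Lambda> g else 0)"
    by (intro sum.cong refl inner)
  also have "\<dots> = (\<Sum>g\<in>?G. \<Sum>vs\<in>L. if set vs \<subseteq> fixed_space n g then irr_character \<Lambda> g else 0)"
    by (rule sum.swap)
  also have "\<dots> = (\<Sum>g\<in>?G. of_nat (CARD('f) ^ fixed_dim n g) ^ r * irr_character \<Lambda> g)"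
  proof (rule sum.cong[OF refl])
    fix g assume "g \<in> ?G"
    then have g: "g \<in> carrier_mat n n" by (simp add: GL_carrier)
    have fs: "fixed_space n g \<subseteq> ?V" by (auto simp: fixed_space_def)
    have "{vs \<in> L. set vs \<subseteq> fixed_space n g} = {vs. set vs \<subseteq> fixed_space n g \<and> length vs = r}"
      using fs by (auto simp: L_def)
    then have "card {vs \<in> L. set vs \<subseteq> fixed_space n g} = (CARD('f) ^ fixed_dim n g) ^ r"
      using card_lists_length_eq[OF finite_subset[OF fs finite_carrier_vec']] card_fixed_space[OF g] by simp
    then show "(\<Sum>vs\<in>L. if set vs \<subseteq> fixed_space n g then irr_character \<Lambda> g else 0)
        = of_nat (CARD('f) ^ fixed_dim n g) ^ r * irr_character \<Lambda> g"
      by (simp add: sum.inter_filter[OF finL, symmetric])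
  qed
  finally show ?thesis by (simp add: cardL power_divide sum_divide_distrib)
qed

theorem theorem4p3:
  fixes n q r :: nat
    and \<eta> :: "'f::{field,finite} mat rep"
    and \<Lambda> :: "'f mat rep set"
  assumes "n \<ge> 1"
    and "CARD('f) = q"
    and "is_rep (GL TYPE('f) n) \<eta>"
    and "\<And>g. g \<in> carrier (GL TYPE('f) n) \<Longrightarrow> character \<eta> g = of_nat (q ^ fixed_dim n g)"
    and "\<Lambda> \<in> Irr (GL TYPE('f) n)"
  shows "complex_of_real
           (transition_steps (GL TYPE('f) n) \<eta> r (trivial_irr (GL TYPE('f) n)) \<Lambda>
             / plancherel (GL TYPE('f) n) \<Lambda>)
         = (\<Sum>a = 0..n. complex_of_real (prob_span_dim TYPE('f) a r n) * (c_coeff n a \<Lambda> / of_nat (irr_dim \<Lambda>)))"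
proof -
  interpret G: fin_group "GL TYPE('f) n" by (rule fin_group_GL)
  let ?GL = "GL TYPE('f) n"
  let ?N = "card (carrier_vec n :: 'f vec set)"
  \<comment> \<open>The degree of \<open>\<eta>\<close> is its character at the identity, which fixes every vector, so it counts the vectors.\<close>
  have "fixed_space n (1\<^sub>m n :: 'f mat) = carrier_vec n" by (auto simp: fixed_space_def)
  then have "?N = q ^ fixed_dim n (1\<^sub>m n :: 'f mat)"
    using card_fixed_space[of "1\<^sub>m n :: 'f mat" n] assms(2) by simp
  moreover have "of_nat (fst \<eta>) = (of_nat (q ^ fixed_dim n (1\<^sub>m n :: 'f mat)) :: complex)"
    using G.character_one[OF assms(3)] assms(4)[OF G.one_closed] by (simp add: GL_one)
  ultimately have deg: "fst \<eta> = ?N" by (simp only: of_nat_eq_iff)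
  have inv_dim: "fixed_dim n (inv\<^bsub>?GL\<^esub> g) = fixed_dim n g" if g: "g \<in> carrier ?GL" for g
  proof -
    have "inv\<^bsub>?GL\<^esub> g * g = 1\<^sub>m n" "g * inv\<^bsub>?GL\<^esub> g = 1\<^sub>m n"
      using G.l_inv[OF g] G.r_inv[OF g] by (simp_all add: GL_mult GL_one)
    then show ?thesis unfolding fixed_dim_def
      using fixed_space_inverse[of g n "inv\<^bsub>?GL\<^esub> g"] g G.inv_closed[OF g] by (simp add: GL_carrier)
  qed
  let ?w = "\<lambda>g. (of_nat (q ^ fixed_dim n g) / of_nat ?N :: complex) ^ r"
  have "complex_of_real (transition_steps ?GL \<eta> r (trivial_irr ?GL) \<Lambda> / plancherel ?GL \<Lambda>)
      = (\<Sum>g\<in>carrier ?GL. ?w g * irr_character \<Lambda> (inv\<^bsub>?GL\<^esub> g)) / of_nat (irr_dim \<Lambda>)"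
    unfolding G.transition_steps_over_plancherel[OF assms(3,5)] deg using assms(4) by simp
  also have "(\<Sum>g\<in>carrier ?GL. ?w g * irr_character \<Lambda> (inv\<^bsub>?GL\<^esub> g))
      = (\<Sum>g\<in>carrier ?GL. ?w (inv\<^bsub>?GL\<^esub> g) * irr_character \<Lambda> (inv\<^bsub>?GL\<^esub> g))"
    by (intro sum.cong refl) (simp add: inv_dim)
  also have "\<dots> = (\<Sum>g\<in>carrier ?GL. ?w g * irr_character \<Lambda> g)"
    by (rule sum.reindex_bij_betw[OF G.bij_inv])
  also have "\<dots> = (\<Sum>a = 0..n. complex_of_real (prob_span_dim TYPE('f) a r n) * c_coeff n a \<Lambda>)"
    using sum_prob_span_dim[OF assms(5), of r] assms(2) by simp
  finally show ?thesis by (simp add: sum_divide_distrib)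
qed

end
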